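(* Let $C$ be a smooth projective curve over $\mathbb{C}$ of arbitrary genus with a fixed spin structure (theta characteristic) and a fixed projective coordinate system, let $D$ be an effective divisor on $C$, and let $q\in H^0\big(C,K_C(D)^{\otimes2}\big)$ be a quadratic differential with poles along $D$. Let $\Sigma=(\eta^2-q)_0\subset\overline{T^*C}$ be the (possibly singular) spectral curve, and let $\mathcal{E}$ be the Rees $\mathcal{D}_C$-module quantizing $\Sigma$, generated on each projective coordinate neighborhood $U_\alpha$ by $$P_\alpha(x_\alpha,\hbar)=\Big(\hbar\frac{d}{dx_\alpha}\Big)^2-q_\alpha,\qquad q=q_\alpha\,dx_\alpha^2 .$$ Then the PDE recursion (defined in the context), with an appropriate choice of initial data, provides an all-order WKB analysis for the generator of $\mathcal{E}$ on a small neighborhood in $C$ of each zero or pole of $q$ of odd order. More precisely: Let $p\in C$ be a zero or pole of $q$ of odd order, and let $U_\alpha$ be a small enough simply connected neighborhood of $p$ with projective coordinate $x_\alpha$ such that $\tilde\pi^{-1}(U_\alpha)\subset\widetilde\Sigma$ is also simply connected. Let $z$ be a local coordinate of $\tilde\pi^{-1}(U_\alpha)$ and write $\tilde\pi$ as $x_\alpha=x_\alpha(z)$. Consider a formal expression $$\psi_\alpha(x_\alpha,\hbar)=\exp\Big(\sum_{m=0}^\infty\hbar^{m-1}S_m(x_\alpha)\Big)$$ in which $S_0,S_1,S_2$ are solutions of $$(S_0')^2-q_\alpha=0,\qquad S_0''+2S_0'S_1'=0,\qquad S_1''+2S_2'S_0'+(S_1')^2=0$$ ($'=d/dx_\alpha$).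 Put $W_{0,1}=\nu^*i^*\eta$, and let $\Omega$, $W_{0,2}$, $\omega^{a-b}$ be as in the context. Define initial data $$F_{1,1}(z_1)=-\int^{z_1}\frac{W_{0,2}(z_1,\tilde\sigma(z_1))}{\Omega(z_1)}$$ (a primitive on $\tilde\pi^{-1}(U_\alpha)$), and $$F_{0,3}(z_1,z_2,z_3)=-\iiint W(z_1,z_2,z_3)+2\big(f(z_1)+f(z_2)+f(z_3)\big),$$ where $$W(z_1,z_2,z_3)=\frac{1}{\Omega(z_1)}\Big(W_{0,2}(z_1,z_2)W_{0,2}(z_1,\tilde\sigma(z_3))+W_{0,2}(z_1,z_3)W_{0,2}(z_1,\tilde\sigma(z_2))\Big)$$ $$+d_2\Big(\frac{\omega^{\tilde\sigma(z_2)-z_2}(z_1)\,W_{0,2}(z_2,\tilde\sigma(z_3))}{\Omega(z_2)}\Big)+d_3\Big(\frac{\omega^{\tilde\sigma(z_3)-z_3}(z_1)\,W_{0,2}(z_2,\tilde\sigma(z_3))}{\Omega(z_3)}\Big),$$ $$f(z)=\widetilde S_2(z)-\Big(F_{1,1}(z)-\frac16\iiint^{z}W(z_1,z_2,z_3)\Big),\qquad \widetilde S_2(z)=S_2(x_\alpha(z)),$$ so that $S_2(x_\alpha)=F_{1,1}(z(x_\alpha))+\frac16F_{0,3}\big(z(x_\alpha),z(x_\alpha),z(x_\alpha)\big)$ for a local section $z=z(x_\alpha)$ of $\tilde\pi$ over $U_\alpha$. Let $F_{g,n}(z_1,\dots,z_n)$, for $2g-2+n\ge2$, be the symmetric functions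 determined by solving the PDE recursion with these initial data, and define $$S_m(x_\alpha)=\sum_{2g-2+n=m-1}\frac1{n!}F_{g,n}\big(z(x_\alpha),\dots,z(x_\alpha)\big),\qquad m\ge3 .$$ Then $\psi_\alpha$ is the WKB expansion of a solution of the generator of $\mathcal{E}$, i.e. $P_\alpha(x_\alpha,\hbar)\psi_\alpha(x_\alpha,\hbar)=0$ as a formal expansion in $\hbar$; equivalently, in addition to the three equations above, $$S_m''+\sum_{a+b=m+1}S_a'S_b'=0\qquad\text{for all }m\ge2 .$$
   Context: Projective coordinate system: a covering by simply connected coordinate neighborhoods $U_\alpha$ whose coordinates $x_\alpha$ are related by Möbius transformations with matrices in $\mathrm{SL}(2,\mathbb{C})$. $\overline{T^*C}=\mathbb{P}(K_C\oplus\mathcal{O}_C)$ is the compactified cotangent bundle, $\pi$ its projection to $C$, $\eta$ the tautological $1$-form ($\eta=y\,dx$), $i:\Sigma\to\overline{T^*C}$ the inclusion, $\nu:\widetilde\Sigma\to\Sigma$ the normalization (realized as the proper transform of $\Sigma$ in an iterated blow-up of $\overline{T^*C}$), and $\tilde\pi=\pi\circ\nu:\widetilde\Sigma\to C$ the resulting degree $2$ Galois covering, with Galois involution $\tilde\sigma$ induced by $y\mapsto-y$; $\tilde\pi$ is simply ramified over zeros and poles of $q$ of odd order. The function $S_0$ and the local section $z=z(x_\alpha)$ correspond to each other by $dS_0=y\,dx_\alpha=$ the pullback of $W_{0,1}$ by the section. The functions $S_m$ are considered on $U_\alpha\setminus\{p\}$, possibly multivalued there (equivalently, as functions of $z$).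 Given data: $\Omega:=\tilde\sigma^*W_{0,1}-W_{0,1}$. Let $E(z_1,z_2)$ be the ($A$-cycle normalized) Riemann prime form on $\widetilde\Sigma\times\widetilde\Sigma$ for a chosen symplectic basis of $H_1(\widetilde\Sigma,\mathbb{Z})$ whose $A$-cycles extend the $A$-cycles of $C$, and a chosen theta characteristic on $\widetilde\Sigma$ with one-dimensional space of sections. $W_{0,2}(z_1,z_2)=d_1d_2\log E(z_1,z_2)$, a meromorphic bidifferential with second order poles on the diagonal. $\omega^{a-b}(z)=d_z\log\frac{E(a,z)}{E(b,z)}$, a meromorphic $1$-form in $z$ with simple poles at $z=a$ (residue $1$) and $z=b$ (residue $-1$), with $a,b$ restricted to a fundamental domain of the universal covering. $d_j$ is exterior differentiation in $z_j$. Multiple integrals denote primitives in the respective variables; $\iiint^z$ denotes the primitive evaluated at $z_1=z_2=z_3=z$. Dividing by $\Omega$ means multiplying by the meromorphic section $1/\Omega$ of the anticanonical bundle. PDE recursion: for all $(g,n)$ with $2g-2+n\ge2$, on $U^n$ with $U\subset\widetilde\Sigma$ open, $$d_1F_{g,n}(z_1,\dots,z_n)=\sum_{j=2}^n\Big[\frac{\omega^{z_j-\tilde\sigma(z_j)}(z_1)}{\Omega(z_1)}d_1F_{g,n-1}(z_{[\hat j]})-\frac{\omega^{z_j-\tilde\sigma(z_j)}(z_1)}{\Omega(z_j)}d_jF_{g,n-1}(z_{[\hat1]})\Big]$$ $$+\frac{1}{\Omega(z_1)}d_{u_1}d_{u_2}\Big[F_{g-1,n+1}(u_1,u_2,z_{[\hat1]})+\sum^{\text{stable}}_{g_1+g_2=g,\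 I\sqcup J=[\hat1]}F_{g_1,|I|+1}(u_1,z_I)F_{g_2,|J|+1}(u_2,z_J)\Big]\Big|_{u_1=u_2=z_1},$$ where $[\hat j]=\{1,\dots,n\}\setminus\{j\}$, $z_I=(z_i)_{i\in I}$, and "stable" means $2g_1-1+|I|>0$ and $2g_2-1+|J|>0$. The initial data are a function $F_{1,1}(z_1)$ on $U$ and a symmetric function $F_{0,3}(z_1,z_2,z_3)$ on $U^3$. *)

theory Defs
  imports
    "HOL-Complex_Analysis.Complex_Analysis"
    "HOL-Homology.Homology"
    "HOL-Library.Multiset"
begin

section \<open>Riemann surfaces\<close>

text \<open>The underlying space is a whole Hausdorff type; the complex structure is an indexed family of
  pairs (simply connected coordinate neighbourhood, coordinate).\<close>

type_synonym ('i, 'a) atlas = "'i \<Rightarrow> 'a set \<times> ('a \<Rightarrow> complex)"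

abbreviation nbhd :: "('i, 'a) atlas \<Rightarrow> 'i \<Rightarrow> 'a set" where
  "nbhd A i \<equiv> fst (A i)"

abbreviation coord :: "('i, 'a) atlas \<Rightarrow> 'i \<Rightarrow> 'a \<Rightarrow> complex" where
  "coord A i \<equiv> snd (A i)"

abbreviation cimage :: "('i, 'a) atlas \<Rightarrow> 'i \<Rightarrow> complex set" where
  "cimage A i \<equiv> coord A i ` nbhd A i"

definition chart_inv :: "('i, 'a) atlas \<Rightarrow> 'i \<Rightarrow> complex \<Rightarrow> 'a" where
  "chart_inv A i = inv_into (nbhd A i) (coord A i)"

definition chart_at :: "('i, 'a) atlas \<Rightarrow> 'a \<Rightarrow> 'i" where
  "chart_at A p = (SOME i. p \<in> nbhd A i)"

definition riemann_surface :: "('i, 'a::t2_space) atlas \<Rightarrow> bool" where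
  "riemann_surface A \<longleftrightarrow>
     connected (UNIV :: 'a set) \<and>
     (\<Union>i. nbhd A i) = UNIV \<and>
     (\<forall>i. open (nbhd A i) \<and> simply_connected (nbhd A i) \<and> open (cimage A i) \<and>
          homeomorphism (nbhd A i) (cimage A i) (coord A i) (chart_inv A i)) \<and>
     (\<forall>i j. (\<lambda>x. coord A i (chart_inv A j x)) holomorphic_on (coord A j ` (nbhd A i \<inter> nbhd A j)))"

text \<open>A smooth projective curve over the complex numbers, seen as an analytic space.\<close>

definition compact_riemann_surface :: "('i, 'a::t2_space) atlas \<Rightarrow> bool" where
  "compact_riemann_surface A \<longleftrightarrow> riemann_surface A \<and> compact (UNIV :: 'a set)"

definition holo_map ::
  "('i, 'a::t2_space) atlas \<Rightarrow> ('j, 'b::t2_space) atlas \<Rightarrow> ('a \<Rightarrow> 'b) \<Rightarrow> bool" where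
  "holo_map A B f \<longleftrightarrow> continuous_on UNIV f \<and>
     (\<forall>i j. (\<lambda>x. coord B j (f (chart_inv A i x))) holomorphic_on
              (coord A i ` (nbhd A i \<inter> f -` nbhd B j)))"

definition holo_fun :: "('i, 'a::t2_space) atlas \<Rightarrow> 'a set \<Rightarrow> ('a \<Rightarrow> complex) \<Rightarrow> bool" where
  "holo_fun A W f \<longleftrightarrow>
     (\<forall>i. (\<lambda>x. f (chart_inv A i x)) holomorphic_on (coord A i ` (nbhd A i \<inter> W)))"

text \<open>The derivative $dx_i/dx_j$ at a point.\<close>

definition trans_deriv :: "('i, 'a) atlas \<Rightarrow> 'i \<Rightarrow> 'i \<Rightarrow> 'a \<Rightarrow> complex" where
  "trans_deriv A i j p = deriv (\<lambda>x. coord A i (chart_inv A j x)) (coord A j p)"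

text \<open>A differential of weight \<open>k\<close> is the family of its coefficients, $w = w_i\,dx_i^k$. By the
  convention of \<^const>\<open>nicely_meromorphic_on\<close> a coefficient takes the value 0 at its poles.\<close>

definition compatible :: "('i, 'a) atlas \<Rightarrow> nat \<Rightarrow> ('i \<Rightarrow> 'a \<Rightarrow> complex) \<Rightarrow> bool" where
  "compatible A k w \<longleftrightarrow>
     (\<forall>i j. \<forall>p \<in> nbhd A i \<inter> nbhd A j. w j p = w i p * trans_deriv A i j p ^ k)"

definition mero_differential :: "('i, 'a) atlas \<Rightarrow> nat \<Rightarrow> ('i \<Rightarrow> 'a \<Rightarrow> complex) \<Rightarrow> bool" where
  "mero_differential A k w \<longleftrightarrow> compatible A k w \<and>
     (\<forall>i. (\<lambda>x. w i (chart_inv A i x)) nicely_meromorphic_on (cimage A i))"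

definition holo_differential :: "('i, 'a) atlas \<Rightarrow> nat \<Rightarrow> ('i \<Rightarrow> 'a \<Rightarrow> complex) \<Rightarrow> bool" where
  "holo_differential A k w \<longleftrightarrow> compatible A k w \<and>
     (\<forall>i. (\<lambda>x. w i (chart_inv A i x)) holomorphic_on (cimage A i))"

definition pullback_form ::
  "('i, 'a) atlas \<Rightarrow> ('j, 'b) atlas \<Rightarrow> ('a \<Rightarrow> 'b) \<Rightarrow> ('j \<Rightarrow> 'b \<Rightarrow> complex) \<Rightarrow> 'i \<Rightarrow> 'a \<Rightarrow> complex" where
  "pullback_form A B f w i p =
     (let j = chart_at B (f p) in
        w j (f p) * deriv (\<lambda>x. coord B j (f (chart_inv A i x))) (coord A i p))"

text \<open>Projective coordinates: $x_i = (a x_j + b)/(c x_j + d)$ with $ad - bc = 1$.\<close>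

definition projective_coordinates :: "('i, 'a) atlas \<Rightarrow> bool" where
  "projective_coordinates A \<longleftrightarrow>
     (\<forall>i j. \<exists>a b c d. a * d - b * c = 1 \<and>
        (\<forall>p \<in> nbhd A i \<inter> nbhd A j.
           c * coord A j p + d \<noteq> 0 \<and>
           coord A i p = (a * coord A j p + b) / (c * coord A j p + d)))"

text \<open>A spin structure, i.e. a line bundle whose square is the canonical bundle, given by its
  transition functions $\xi_{ij} = \sqrt{dx_j/dx_i}$. Every theta characteristic has such a
  description since the coordinate neighbourhoods are simply connected.\<close>

definition theta_characteristic :: "('i, 'a) atlas \<Rightarrow> ('i \<Rightarrow> 'i \<Rightarrow> 'a \<Rightarrow> complex) \<Rightarrow> bool" where
  "theta_characteristic A \<xi> \<longleftrightarrow>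
     (\<forall>i j. (\<lambda>x. \<xi> i j (chart_inv A i x)) holomorphic_on (coord A i ` (nbhd A i \<inter> nbhd A j))) \<and>
     (\<forall>i j. \<forall>p \<in> nbhd A i \<inter> nbhd A j. (\<xi> i j p)\<^sup>2 = trans_deriv A j i p) \<and>
     (\<forall>i j k. \<forall>p \<in> nbhd A i \<inter> nbhd A j \<inter> nbhd A k. \<xi> i j p * \<xi> j k p = \<xi> i k p)"

definition theta_section ::
  "('i, 'a) atlas \<Rightarrow> ('i \<Rightarrow> 'i \<Rightarrow> 'a \<Rightarrow> complex) \<Rightarrow> ('i \<Rightarrow> 'a \<Rightarrow> complex) \<Rightarrow> bool" where
  "theta_section A \<xi> h \<longleftrightarrow>
     (\<forall>i. (\<lambda>x. h i (chart_inv A i x)) holomorphic_on (cimage A i)) \<and>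
     (\<forall>i j. \<forall>p \<in> nbhd A i \<inter> nbhd A j. h i p = \<xi> i j p * h j p)"

definition one_dim_sections :: "('i, 'a) atlas \<Rightarrow> ('i \<Rightarrow> 'i \<Rightarrow> 'a \<Rightarrow> complex) \<Rightarrow> bool" where
  "one_dim_sections A \<xi> \<longleftrightarrow>
     (\<exists>h. theta_section A \<xi> h \<and> (\<exists>i. \<exists>p \<in> nbhd A i. h i p \<noteq> 0) \<and>
        (\<forall>h'. theta_section A \<xi> h' \<longrightarrow> (\<exists>c. \<forall>i. \<forall>p \<in> nbhd A i. h' i p = c * h i p)))"

section \<open>Symplectic bases of the first homology\<close>

definition loop_chain :: "(real \<Rightarrow> 'a) \<Rightarrow> 'a chain" where
  "loop_chain \<gamma> = frag_of (restrict (\<lambda>t. \<gamma> (t 1)) (standard_simplex 1))"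

definition homologous_loops :: "(real \<Rightarrow> 'a::topological_space) \<Rightarrow> (real \<Rightarrow> 'a) \<Rightarrow> bool" where
  "homologous_loops \<gamma> \<delta> \<longleftrightarrow> homologous_rel 1 euclidean {} (loop_chain \<gamma>) (loop_chain \<delta>)"

text \<open>Loops are 1-periodic maps of class $C^1$; the velocity is taken in the chart
  \<^const>\<open>chart_at\<close>, which depends only on the point and not on the loop.\<close>

definition c1_loop :: "('i, 'a::t2_space) atlas \<Rightarrow> (real \<Rightarrow> 'a) \<Rightarrow> bool" where
  "c1_loop A \<gamma> \<longleftrightarrow> continuous_on UNIV \<gamma> \<and> (\<forall>t. \<gamma> (t + 1) = \<gamma> t) \<and>
     (\<forall>i. \<forall>t \<in> \<gamma> -` nbhd A i. (\<lambda>s. coord A i (\<gamma> s)) differentiable (at t)) \<and>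
     (\<forall>i. continuous_on (\<gamma> -` nbhd A i) (\<lambda>t. vector_derivative (\<lambda>s. coord A i (\<gamma> s)) (at t)))"

definition velocity :: "('i, 'a) atlas \<Rightarrow> (real \<Rightarrow> 'a) \<Rightarrow> real \<Rightarrow> complex" where
  "velocity A \<gamma> t = vector_derivative (\<lambda>s. coord A (chart_at A (\<gamma> t)) (\<gamma> s)) (at t)"

definition transversal :: "('i, 'a) atlas \<Rightarrow> (real \<Rightarrow> 'a) \<Rightarrow> (real \<Rightarrow> 'a) \<Rightarrow> bool" where
  "transversal A \<gamma> \<delta> \<longleftrightarrow>
     (\<forall>s t. \<gamma> s = \<delta> t \<longrightarrow> Im (cnj (velocity A \<gamma> s) * velocity A \<delta> t) \<noteq> 0)"

definition intersection_number ::
  "('i, 'a) atlas \<Rightarrow> (real \<Rightarrow> 'a) \<Rightarrow> (real \<Rightarrow> 'a) \<Rightarrow> real" where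
  "intersection_number A \<gamma> \<delta> =
     (\<Sum>(s, t) \<in> {(s, t). s \<in> {0..<1} \<and> t \<in> {0..<1} \<and> \<gamma> s = \<delta> t}.
        sgn (Im (cnj (velocity A \<gamma> s) * velocity A \<delta> t)))"

text \<open>Every homology class has a $C^1$ representative, and finitely many of them can be moved into
  mutually transversal position, so representing a symplectic basis by such loops is no restriction.\<close>

definition symplectic_basis ::
  "('i, 'a::t2_space) atlas \<Rightarrow> nat \<Rightarrow> (nat \<Rightarrow> real \<Rightarrow> 'a) \<Rightarrow> (nat \<Rightarrow> real \<Rightarrow> 'a) \<Rightarrow> bool" where
  "symplectic_basis A g a b \<longleftrightarrow>
     (\<forall>j<g. c1_loop A (a j) \<and> c1_loop A (b j)) \<and>
     (\<forall>j<g. \<forall>k<g. transversal A (a j) (b k) \<and>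
        intersection_number A (a j) (b k) = (if j = k then 1 else 0)) \<and>
     (\<forall>j<g. \<forall>k<g. j \<noteq> k \<longrightarrow>
        transversal A (a j) (a k) \<and> intersection_number A (a j) (a k) = 0 \<and>
        transversal A (b j) (b k) \<and> intersection_number A (b j) (b k) = 0) \<and>
     (\<forall>c. singular_relcycle 1 (euclidean :: 'a topology) {} c \<longrightarrow>
        (\<exists>!m :: nat \<Rightarrow> int. (\<forall>k\<ge>2 * g. m k = 0) \<and>
           homologous_rel 1 euclidean {} c
             (\<Sum>k<g. frag_cmul (m k) (loop_chain (a k)) + frag_cmul (m (g + k)) (loop_chain (b k)))))"

definition period :: "('i, 'a) atlas \<Rightarrow> ('i \<Rightarrow> 'a \<Rightarrow> complex) \<Rightarrow> (real \<Rightarrow> 'a) \<Rightarrow> complex" where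
  "period A w \<gamma> = integral {0..1} (\<lambda>t. w (chart_at A (\<gamma> t)) (\<gamma> t) * velocity A \<gamma> t)"

section \<open>The prime form\<close>

definition universal_covering :: "('u::t2_space \<Rightarrow> 'a::t2_space) \<Rightarrow> bool" where
  "universal_covering pr \<longleftrightarrow> covering_space UNIV pr UNIV \<and>
     connected (UNIV :: 'u set) \<and> simply_connected (UNIV :: 'u set)"

text \<open>Local inverses of the covering map followed by a chart are the coordinates upstairs.\<close>

definition sheet :: "('i, 'a) atlas \<Rightarrow> ('u::t2_space \<Rightarrow> 'a) \<Rightarrow> 'i \<Rightarrow> 'u set \<Rightarrow> bool" where
  "sheet A pr i T \<longleftrightarrow> open T \<and> inj_on pr T \<and> pr ` T \<subseteq> nbhd A i"

definition sheet_inv :: "('i, 'a) atlas \<Rightarrow> ('u \<Rightarrow> 'a) \<Rightarrow> 'i \<Rightarrow> 'u set \<Rightarrow> complex \<Rightarrow> 'u" where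
  "sheet_inv A pr i T x = inv_into T pr (chart_inv A i x)"

definition primitive_on_cover ::
  "('i, 'a) atlas \<Rightarrow> ('u::t2_space \<Rightarrow> 'a) \<Rightarrow> ('i \<Rightarrow> 'a \<Rightarrow> complex) \<Rightarrow> ('u \<Rightarrow> complex) \<Rightarrow> bool" where
  "primitive_on_cover A pr w V \<longleftrightarrow>
     (\<forall>i T. sheet A pr i T \<longrightarrow> (\<forall>x \<in> coord A i ` pr ` T.
        ((\<lambda>x. V (sheet_inv A pr i T x)) has_field_derivative w i (chart_inv A i x)) (at x)))"

text \<open>The prime form for the theta characteristic \<open>\<xi>\<close> and the symplectic basis \<open>a\<close>, \<open>b\<close>: the
  $(-\frac12,-\frac12)$-form
  $E(u,v) = E_{ij}(u,v)\,(dx_i)^{-1/2}(dx_j)^{-1/2}$ on the square of the universal covering that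
  is holomorphic and antisymmetric, vanishes exactly over the diagonal, is normalized by
  $E(u,v) \sim (x(u)-x(v))\,(dx)^{-1/2}(dx)^{-1/2}$, is invariant under the \<open>a\<close>-cycles, and has along
  $b_k$ the multiplier $\exp(-\pi i\tau_{kk} - 2\pi i\int_u^v \omega_k)$, where $\omega_k$ are the
  \<open>a\<close>-normalized holomorphic 1-forms and $\tau$ is their period matrix. The multipliers hold up to
  signs determined by \<open>\<xi>\<close>, which is why they are stated for $E^2$; the conditions still determine
  $E$ up to a global sign. Continuity together with separate holomorphy is joint holomorphy.\<close>

definition prime_form ::
  "('i, 'a::t2_space) atlas \<Rightarrow> ('i \<Rightarrow> 'i \<Rightarrow> 'a \<Rightarrow> complex) \<Rightarrow>
   nat \<Rightarrow> (nat \<Rightarrow> real \<Rightarrow> 'a) \<Rightarrow> (nat \<Rightarrow> real \<Rightarrow> 'a) \<Rightarrow>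
   ('u::t2_space \<Rightarrow> 'a) \<Rightarrow> ('i \<Rightarrow> 'i \<Rightarrow> 'u \<Rightarrow> 'u \<Rightarrow> complex) \<Rightarrow> bool" where
  "prime_form A \<xi> g a b pr E \<longleftrightarrow>
     (\<forall>i j. continuous_on (pr -` nbhd A i \<times> pr -` nbhd A j) (\<lambda>(u, v). E i j u v)) \<and>
     (\<forall>i j v T. pr v \<in> nbhd A j \<and> sheet A pr i T \<longrightarrow>
        (\<lambda>x. E i j (sheet_inv A pr i T x) v) holomorphic_on (coord A i ` pr ` T)) \<and>
     (\<forall>i j u T. pr u \<in> nbhd A i \<and> sheet A pr j T \<longrightarrow>
        (\<lambda>x. E i j u (sheet_inv A pr j T x)) holomorphic_on (coord A j ` pr ` T)) \<and>
     (\<forall>i i' j j' u v. pr u \<in> nbhd A i \<inter> nbhd A i' \<and> pr v \<in> nbhd A j \<inter> nbhd A j' \<longrightarrow>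
        E i' j' u v = \<xi> i i' (pr u) * \<xi> j j' (pr v) * E i j u v) \<and>
     (\<forall>i j u v. pr u \<in> nbhd A i \<and> pr v \<in> nbhd A j \<longrightarrow> E j i v u = - E i j u v) \<and>
     (\<forall>i j u v. pr u \<in> nbhd A i \<and> pr v \<in> nbhd A j \<longrightarrow> (E i j u v = 0 \<longleftrightarrow> pr u = pr v)) \<and>
     (\<forall>i u. pr u \<in> nbhd A i \<longrightarrow>
        ((\<lambda>v. E i i u v / (coord A i (pr u) - coord A i (pr v))) \<longlongrightarrow> 1) (at u)) \<and>
     (\<exists>\<omega> V.
        (\<forall>k<g. holo_differential A 1 (\<omega> k) \<and> primitive_on_cover A pr (\<omega> k) (V k) \<and>
           (\<forall>j<g. period A (\<omega> k) (a j) = (if j = k then 1 else 0))) \<and>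
        (\<forall>k<g. \<forall>\<gamma> i j u. path \<gamma> \<and> pr (pathstart \<gamma>) = pr (pathfinish \<gamma>) \<and>
           pr u \<in> nbhd A i \<and> pr (pathstart \<gamma>) \<in> nbhd A j \<longrightarrow>
           (homologous_loops (pr \<circ> \<gamma>) (a k) \<longrightarrow>
              (E i j u (pathfinish \<gamma>))\<^sup>2 = (E i j u (pathstart \<gamma>))\<^sup>2) \<and>
           (homologous_loops (pr \<circ> \<gamma>) (b k) \<longrightarrow>
              (E i j u (pathfinish \<gamma>))\<^sup>2 =
                (exp (- (pi * \<i> * period A (\<omega> k) (b k))
                      - 2 * pi * \<i> * (V k (pathstart \<gamma>) - V k u)) * E i j u (pathstart \<gamma>))\<^sup>2)))"

section \<open>Quadratic differentials and spectral curves\<close>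

abbreviation coef :: "('i, 'c) atlas \<Rightarrow> ('i \<Rightarrow> 'c \<Rightarrow> complex) \<Rightarrow> 'i \<Rightarrow> complex \<Rightarrow> complex" where
  "coef A q i \<equiv> \<lambda>x. q i (chart_inv A i x)"

definition effective_divisor :: "('c \<Rightarrow> nat) \<Rightarrow> bool" where
  "effective_divisor D \<longleftrightarrow> finite {c. D c \<noteq> 0}"

text \<open>Global sections of $K_C(D)^{\otimes 2}$: poles of order at most $2D(c)$ at $c$.\<close>

definition quadratic_differential ::
  "('i, 'c) atlas \<Rightarrow> ('c \<Rightarrow> nat) \<Rightarrow> ('i \<Rightarrow> 'c \<Rightarrow> complex) \<Rightarrow> bool" where
  "quadratic_differential A D q \<longleftrightarrow> mero_differential A 2 q \<and>
     (\<forall>i. \<forall>c \<in> nbhd A i. is_pole (coef A q i) (coord A i c) \<longrightarrow>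
        - zorder (coef A q i) (coord A i c) \<le> 2 * int (D c))"

definition odd_order_point ::
  "('i, 'c) atlas \<Rightarrow> ('i \<Rightarrow> 'c \<Rightarrow> complex) \<Rightarrow> 'i \<Rightarrow> 'c \<Rightarrow> bool" where
  "odd_order_point A q i p \<longleftrightarrow> p \<in> nbhd A i \<and>
     (\<exists>\<^sub>F x in at (coord A i p). coef A q i x \<noteq> 0) \<and>
     odd (zorder (coef A q i) (coord A i p))"

text \<open>Points of $\overline{T^*C}$ over \<open>c\<close> are given by their fibre coordinates $y_i$ in all
  trivializations $\eta = y_i\,dx_i$ near \<open>c\<close>, with \<open>None\<close> for the point at infinity. The fibre
  coordinates of charts not containing \<open>c\<close> carry the dummy value \<open>Some 0\<close>.\<close>

type_synonym ('i, 'c) cotangent_point = "'c \<times> ('i \<Rightarrow> complex option)"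

definition compactified_cotangent :: "('i, 'c) atlas \<Rightarrow> ('i, 'c) cotangent_point set" where
  "compactified_cotangent A = {(c, y).
     (\<forall>i. c \<notin> nbhd A i \<longrightarrow> y i = Some 0) \<and>
     ((\<forall>i. c \<in> nbhd A i \<longrightarrow> y i = None) \<or>
      (\<exists>v. (\<forall>i. c \<in> nbhd A i \<longrightarrow> y i = Some (v i)) \<and>
           (\<forall>i j. c \<in> nbhd A i \<inter> nbhd A j \<longrightarrow> v j = v i * trans_deriv A i j c)))}"

text \<open>Near the section at infinity the equation $y^2 = q$ reads $w^2 = 1/q$ with $w = 1/y$, so the
  zero divisor of $\eta^2 - q$ meets this section exactly over the poles of $q$.\<close>

definition spectral_curve ::
  "('i, 'c) atlas \<Rightarrow> ('i \<Rightarrow> 'c \<Rightarrow> complex) \<Rightarrow> ('i, 'c) cotangent_point set" where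
  "spectral_curve A q = {(c, y) \<in> compactified_cotangent A.
     \<forall>i. c \<in> nbhd A i \<longrightarrow>
       (case y i of
          Some v \<Rightarrow> \<not> is_pole (coef A q i) (coord A i c) \<and> v\<^sup>2 = q i c
        | None \<Rightarrow> is_pole (coef A q i) (coord A i c))}"

definition fibre_recip :: "complex option \<Rightarrow> complex" where
  "fibre_recip y = (case y of Some v \<Rightarrow> 1 / v | None \<Rightarrow> 0)"

text \<open>Holomorphy of a map into $\overline{T^*C}$ in the charts $(x_i, y_i)$ and $(x_i, 1/y_i)$.\<close>

definition holo_to_cotangent ::
  "('j, 's::t2_space) atlas \<Rightarrow> ('i, 'c::t2_space) atlas \<Rightarrow> ('s \<Rightarrow> ('i, 'c) cotangent_point) \<Rightarrow> bool" where
  "holo_to_cotangent B A \<nu> \<longleftrightarrow> range \<nu> \<subseteq> compactified_cotangent A \<and> holo_map B A (fst \<circ> \<nu>) \<and>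
     (\<forall>i. let Fin = {s. fst (\<nu> s) \<in> nbhd A i \<and> snd (\<nu> s) i \<noteq> None};
              Nonzero = {s. fst (\<nu> s) \<in> nbhd A i \<and> snd (\<nu> s) i \<noteq> Some 0} in
        open Fin \<and> holo_fun B Fin (\<lambda>s. the (snd (\<nu> s) i)) \<and>
        open Nonzero \<and> holo_fun B Nonzero (\<lambda>s. fibre_recip (snd (\<nu> s) i)))"

text \<open>The normalization of the irreducible curve \<open>X\<close>: a compact connected Riemann surface mapped
  holomorphically onto \<open>X\<close> with finite fibres, injectively outside finitely many points.\<close>

definition normalization ::
  "('j, 's::t2_space) atlas \<Rightarrow> ('i, 'c::t2_space) atlas \<Rightarrow> ('i, 'c) cotangent_point set \<Rightarrow>
   ('s \<Rightarrow> ('i, 'c) cotangent_point) \<Rightarrow> bool" where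
  "normalization B A X \<nu> \<longleftrightarrow> compact_riemann_surface B \<and> holo_to_cotangent B A \<nu> \<and> range \<nu> = X \<and>
     (\<exists>Sing. finite Sing \<and> finite (\<nu> -` Sing) \<and> inj_on \<nu> (- (\<nu> -` Sing)))"

definition negate_fibre :: "('i, 'c) cotangent_point \<Rightarrow> ('i, 'c) cotangent_point" where
  "negate_fibre P = (fst P, \<lambda>i. map_option uminus (snd P i))"

definition galois_involution ::
  "('j, 's::t2_space) atlas \<Rightarrow> ('s \<Rightarrow> ('i, 'c) cotangent_point) \<Rightarrow> ('s \<Rightarrow> 's) \<Rightarrow> bool" where
  "galois_involution B \<nu> \<sigma> \<longleftrightarrow> holo_map B B \<sigma> \<and> (\<forall>s. \<nu> (\<sigma> s) = negate_fibre (\<nu> s))"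

text \<open>$W_{0,1} = \nu^* i^* \eta$ with $\eta = y\,dx$. Since $y$ may be infinite where
  $dx$ vanishes, the coefficient is the limit of $y\,\frac{dx}{dz}$ if it exists, and 0 at a pole.\<close>

definition W01 ::
  "('j, 's) atlas \<Rightarrow> ('i, 'c) atlas \<Rightarrow> ('s \<Rightarrow> ('i, 'c) cotangent_point) \<Rightarrow> 'j \<Rightarrow> 's \<Rightarrow> complex" where
  "W01 B A \<nu> k s =
     (let i = chart_at A (fst (\<nu> s)) in
        remove_sings (\<lambda>z. the (snd (\<nu> (chart_inv B k z)) i) *
                          deriv (\<lambda>z. coord A i (fst (\<nu> (chart_inv B k z)))) z) (coord B k s))"

definition Omega ::
  "('j, 's) atlas \<Rightarrow> ('i, 'c) atlas \<Rightarrow> ('s \<Rightarrow> ('i, 'c) cotangent_point) \<Rightarrow> ('s \<Rightarrow> 's) \<Rightarrow>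
   'j \<Rightarrow> 's \<Rightarrow> complex" where
  "Omega B A \<nu> \<sigma> k s = pullback_form B B \<sigma> (W01 B A \<nu>) k s - W01 B A \<nu> k s"

section \<open>Expressions in a local coordinate\<close>

text \<open>From here on differentials are represented by their coefficients with respect to one
  coordinate $z$ of the surface, defined on a \<open>\<sigma>\<close>-stable neighbourhood; \<open>sg\<close> is $\tilde\sigma$ and
  \<open>e\<close> is the prime form in this coordinate (after lifting the neighbourhood to the universal
  covering), and \<open>Om\<close> is $\Omega$. Derivatives of $\log E$ are written as logarithmic derivatives.\<close>

definition local_prime ::
  "('j, 's) atlas \<Rightarrow> 'j \<Rightarrow> ('s \<Rightarrow> 'u) \<Rightarrow> ('j \<Rightarrow> 'j \<Rightarrow> 'u \<Rightarrow> 'u \<Rightarrow> complex) \<Rightarrow>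
   complex \<Rightarrow> complex \<Rightarrow> complex" where
  "local_prime B k lift E z w = E k k (lift (chart_inv B k z)) (lift (chart_inv B k w))"

definition W02 :: "(complex \<Rightarrow> complex \<Rightarrow> complex) \<Rightarrow> complex \<Rightarrow> complex \<Rightarrow> complex" where
  "W02 e z1 z2 = deriv (\<lambda>s. deriv (\<lambda>t. e s t) z2 / e s z2) z1"

text \<open>$W_{0,2}(z_1,\tilde\sigma(z_2))$: the second argument is pulled back as a differential.\<close>

definition W02s ::
  "(complex \<Rightarrow> complex \<Rightarrow> complex) \<Rightarrow> (complex \<Rightarrow> complex) \<Rightarrow> complex \<Rightarrow> complex \<Rightarrow> complex" where
  "W02s e sg z1 z2 = W02 e z1 (sg z2) * deriv sg z2"

text \<open>$\omega^{a-b}(z)$.\<close>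

definition omega ::
  "(complex \<Rightarrow> complex \<Rightarrow> complex) \<Rightarrow> complex \<Rightarrow> complex \<Rightarrow> complex \<Rightarrow> complex" where
  "omega e a b z = deriv (\<lambda>t. e a t) z / e a z - deriv (\<lambda>t. e b t) z / e b z"

definition W03 ::
  "(complex \<Rightarrow> complex \<Rightarrow> complex) \<Rightarrow> (complex \<Rightarrow> complex) \<Rightarrow> (complex \<Rightarrow> complex) \<Rightarrow>
   complex \<Rightarrow> complex \<Rightarrow> complex \<Rightarrow> complex" where
  "W03 e sg Om z1 z2 z3 =
     1 / Om z1 * (W02 e z1 z2 * W02s e sg z1 z3 + W02 e z1 z3 * W02s e sg z1 z2)
     + deriv (\<lambda>t. omega e (sg t) t z1 * W02s e sg t z3 / Om t) z2
     + deriv (\<lambda>t. omega e (sg t) t z1 * W02s e sg z2 t / Om t) z3"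

text \<open>Functions of $n$ variables take a list of length $n$.\<close>

definition multi_holomorphic :: "complex set \<Rightarrow> nat \<Rightarrow> (complex list \<Rightarrow> complex) \<Rightarrow> bool" where
  "multi_holomorphic U n F \<longleftrightarrow>
     (\<forall>zs. length zs = n \<and> set zs \<subseteq> U \<longrightarrow>
        (\<forall>i<n. (\<lambda>u. F (zs[i := u])) holomorphic_on U) \<and>
        (\<forall>\<epsilon>>0. \<exists>\<delta>>0. \<forall>ws. length ws = n \<and> set ws \<subseteq> U \<and> (\<forall>i<n. dist (ws ! i) (zs ! i) < \<delta>) \<longrightarrow>
           dist (F ws) (F zs) < \<epsilon>))"

definition multi_symmetric :: "complex set \<Rightarrow> nat \<Rightarrow> (complex list \<Rightarrow> complex) \<Rightarrow> bool" where
  "multi_symmetric U n F \<longleftrightarrow>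
     (\<forall>zs ws. length zs = n \<and> set zs \<subseteq> U \<and> mset ws = mset zs \<longrightarrow> F ws = F zs)"

text \<open>The PDE recursion for $F_{g,n}(z_1,\dots,z_n)$ = \<open>F g [z1, ..., zn]\<close>, at points where
  $\omega^{z_j-\tilde\sigma(z_j)}(z_1)$ is defined. Here \<open>z\<close> is $z_1$ and \<open>zs ! j\<close> is $z_{j+2}$, and a
  splitting of $\{2,\dots,n\}$ is given by the set \<open>I\<close> of positions in \<open>zs\<close>.\<close>

definition pde_recursion ::
  "complex set \<Rightarrow> (complex \<Rightarrow> complex) \<Rightarrow> (complex \<Rightarrow> complex) \<Rightarrow>
   (complex \<Rightarrow> complex \<Rightarrow> complex \<Rightarrow> complex) \<Rightarrow> (nat \<Rightarrow> complex list \<Rightarrow> complex) \<Rightarrow> bool" where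
  "pde_recursion U sg Om om F \<longleftrightarrow>
     (\<forall>g z zs. z \<in> U \<and> set zs \<subseteq> U \<and> z \<notin> set zs \<and> z \<notin> sg ` set zs \<and>
        2 * int g - 2 + int (length (z # zs)) \<ge> 2 \<longrightarrow>
        deriv (\<lambda>u. F g (u # zs)) z =
          (\<Sum>j<length zs.
             om (zs ! j) (sg (zs ! j)) z / Om z *
               deriv (\<lambda>u. F g (u # take j zs @ drop (Suc j) zs)) z
             - om (zs ! j) (sg (zs ! j)) z / Om (zs ! j) *
               deriv (\<lambda>u. F g (zs[j := u])) (zs ! j))
          + 1 / Om z *
            deriv (\<lambda>u1. deriv (\<lambda>u2.
              (if g = 0 then 0 else F (g - 1) (u1 # u2 # zs)) +
              (\<Sum>(g1, I) \<in> {(g1, I). g1 \<le> g \<and> I \<subseteq> {..<length zs} \<and>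
                    2 * int g1 - 1 + int (card I) > 0 \<and>
                    2 * int (g - g1) - 1 + int (card ({..<length zs} - I)) > 0}.
                 F g1 (u1 # nths zs I) * F (g - g1) (u2 # nths zs ({..<length zs} - I)))) z) z)"

section \<open>WKB expansions\<close>

text \<open>Differential operators $\sum_k c_k(x)\,(\hbar\,d/dx)^k$ are lists of coefficient functions; this
  is the generator over the coordinate neighbourhood \<open>i\<close> of the Rees D-module quantizing the
  spectral curve of \<open>q\<close>, namely $(\hbar\,d/dx_i)^2 - q_i$.\<close>

definition rees_generator ::
  "('i, 'c) atlas \<Rightarrow> ('i \<Rightarrow> 'c \<Rightarrow> complex) \<Rightarrow> 'i \<Rightarrow> (complex \<Rightarrow> complex) list" where
  "rees_generator A q i = [\<lambda>x. - coef A q i x, \<lambda>x. 0, \<lambda>x. 1]"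

text \<open>A formal expression $\psi\varphi$ with $\psi = \exp(\sum_m \hbar^{m-1}S_m)$ and
  $\varphi = \sum_k \hbar^k\varphi_k$ is represented by $\varphi$; then
  $\hbar\frac{d}{dx}(\psi\varphi) = \psi\,(\hbar\varphi' + \sum_m\hbar^m S_m'\,\varphi)$.\<close>

definition wkb_hbar_ddx ::
  "(nat \<Rightarrow> complex \<Rightarrow> complex) \<Rightarrow> (nat \<Rightarrow> complex \<Rightarrow> complex) \<Rightarrow> nat \<Rightarrow> complex \<Rightarrow> complex" where
  "wkb_hbar_ddx S \<phi> k x =
     (if k = 0 then 0 else deriv (\<phi> (k - 1)) x) + (\<Sum>m\<le>k. deriv (S m) x * \<phi> (k - m) x)"

definition wkb_apply ::
  "(complex \<Rightarrow> complex) list \<Rightarrow> (nat \<Rightarrow> complex \<Rightarrow> complex) \<Rightarrow> (nat \<Rightarrow> complex \<Rightarrow> complex) \<Rightarrow>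
   nat \<Rightarrow> complex \<Rightarrow> complex" where
  "wkb_apply P S \<phi> k x = (\<Sum>l<length P. (P ! l) x * (wkb_hbar_ddx S ^^ l) \<phi> k x)"

definition wkb_solution ::
  "(complex \<Rightarrow> complex) list \<Rightarrow> (nat \<Rightarrow> complex \<Rightarrow> complex) \<Rightarrow> complex set \<Rightarrow> bool" where
  "wkb_solution P S N \<longleftrightarrow>
     (\<forall>k. \<forall>x\<in>N. wkb_apply P S (\<lambda>k x. if k = 0 then 1 else 0) k x = 0)"

end

theory Submission
  imports Defs
begin

text \<open>Restrict the PDE recursion to $z_2=\dots=z_n=w$ and let $z_1\to w$. The simple pole of
  $\omega^{w-\tilde\sigma(w)}(z_1)$ at $z_1=w$ turns each difference in the first sum into the derivative of
  $d_1F_{g,n-1}/\Omega$, so in the limit one gets an ordinary differential recursion for the diagonal values.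
  Weighting by $1/n!$ and summing over $2g-2+n=m$, the two kinds of second derivatives combine into
  $S_m''$ and the quadratic terms into $\sum_{a+b=m+1,\,a,b\ge2}S_a'S_b'$. Finally
  $\Omega=-2y\,dx=-2\,dS_0$, and the derivative of $1/\Omega$ is absorbed by the equation for $S_1$, which
  gives the WKB equation.\<close>

section \<open>Holomorphic functions of several variables\<close>

text \<open>The recursion is available only for \<open>z1\<close> different from \<open>w\<close>
  and from the conjugate of \<open>w\<close>, so its diagonal form is a limit, and every term must
  be shown continuous there. Hence the weight on regularity: \<open>multi_holomorphic\<close> means
  separate holomorphy plus joint continuity, and partial derivatives must be shown to be functions
  of the same kind before one may pass to limits or differentiate along the diagonal. With
  \<open>k = n - 1\<close> the condition \<open>2g - 2 + n = m - 1\<close> becomes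
  \<open>2g + k = m\<close>, an additive degree. Differentiating the diagonal values turns the
  weight \<open>1/n!\<close> into \<open>1/k!\<close>, because symmetry contributes a factor
  \<open>n\<close>; this weight converts the splittings of the variables into a Cauchy product.
  Everything happens on one branch \<open>U\<close> of the covering, away from the point over
  \<open>p\<close>. There the fibre coordinate is finite and nonzero, so the involution moves every
  point and \<open>Omega\<close> has no zero.\<close>

lemma multi_holomorphic_holomorphic:
  assumes "multi_holomorphic U n F" "length zs = n" "set zs \<subseteq> U" "i < n"
  shows "(\<lambda>u. F (zs[i := u])) holomorphic_on U"
  using assms unfolding multi_holomorphic_def by blast

lemma multi_symmetricD:
  assumes "multi_symmetric U n F" "length zs = n" "set zs \<subseteq> U" "mset ws = mset zs"
  shows "F ws = F zs"
  using assms unfolding multi_symmetric_def by blast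

lemma multi_holomorphic_Cons:
  assumes "multi_holomorphic U n F" "n = Suc (length zs)" "set zs \<subseteq> U"
  shows "(\<lambda>u. F (u # zs)) holomorphic_on U"
proof (cases "U = {}")
  case False
  then obtain a where "a \<in> U" by blast
  then show ?thesis
    using multi_holomorphic_holomorphic[OF assms(1), of "a # zs" 0] assms by simp
qed (auto simp: holomorphic_on_def)

lemma multi_holomorphic_append:
  assumes "multi_holomorphic U n F" "n = length xs + Suc (length zs)" "set xs \<subseteq> U" "set zs \<subseteq> U"
  shows "(\<lambda>u. F (xs @ u # zs)) holomorphic_on U"
proof (cases "U = {}")
  case False
  then obtain a where "a \<in> U" by blast
  then show ?thesis
    using multi_holomorphic_holomorphic[OF assms(1), of "xs @ a # zs" "length xs"] assms by simp
qed (auto simp: holomorphic_on_def)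

lemma multi_holomorphic_continuous:
  assumes "multi_holomorphic U n F" "length zs = n" "set zs \<subseteq> U" "\<epsilon> > 0"
  obtains \<delta> where "\<delta> > 0" "\<And>ws. length ws = n \<Longrightarrow> set ws \<subseteq> U \<Longrightarrow>
    (\<And>i. i < n \<Longrightarrow> dist (ws ! i) (zs ! i) < \<delta>) \<Longrightarrow> dist (F ws) (F zs) < \<epsilon>"
  using assms unfolding multi_holomorphic_def by metis

lemma multi_holomorphic_tendsto:
  assumes F: "multi_holomorphic U n F" "length zs = n" "set zs \<subseteq> U"
    and ev: "eventually (\<lambda>p. length (c p) = n \<and> set (c p) \<subseteq> U) X"
    and lim: "\<And>i. i < n \<Longrightarrow> ((\<lambda>p. c p ! i) \<longlongrightarrow> zs ! i) X"
  shows "((\<lambda>p. F (c p)) \<longlongrightarrow> F zs) X"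
proof (rule tendstoI)
  fix \<epsilon> :: real assume "\<epsilon> > 0"
  then obtain \<delta> where \<delta>: "\<delta> > 0" "\<And>ws. length ws = n \<Longrightarrow> set ws \<subseteq> U \<Longrightarrow>
    (\<And>i. i < n \<Longrightarrow> dist (ws ! i) (zs ! i) < \<delta>) \<Longrightarrow> dist (F ws) (F zs) < \<epsilon>"
    using multi_holomorphic_continuous[OF F] by blast
  have "eventually (\<lambda>p. \<forall>i\<in>{..<n}. dist (c p ! i) (zs ! i) < \<delta>) X"
    using lim \<delta>(1) by (intro eventually_ball_finite) (auto dest: tendstoD)
  with ev show "eventually (\<lambda>p. dist (F (c p)) (F zs) < \<epsilon>) X"
    by eventually_elim (use \<delta>(2) in auto)
qed

text \<open>A tube lemma: continuity at each point \<open>t # zs\<close> gives a radius depending on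
  \<open>t\<close>, and compactness of \<open>K\<close> leaves finitely many of them. The uniform
  radius makes Cauchy estimates in the first variable possible.\<close>

lemma multi_holomorphic_uniform:
  assumes F: "multi_holomorphic U (Suc (length zs)) F" and zs: "set zs \<subseteq> U"
    and K: "compact K" "K \<subseteq> U" and "\<epsilon> > 0"
  obtains \<delta> where "\<delta> > 0" "\<And>t ws. t \<in> K \<Longrightarrow> length ws = length zs \<Longrightarrow> set ws \<subseteq> U \<Longrightarrow>
    (\<And>i. i < length zs \<Longrightarrow> dist (ws ! i) (zs ! i) < \<delta>) \<Longrightarrow> dist (F (t # ws)) (F (t # zs)) < \<epsilon>"
proof -
  have "\<exists>\<delta>>0. \<forall>ws. length ws = Suc (length zs) \<longrightarrow> set ws \<subseteq> U \<longrightarrow>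
    (\<forall>i<Suc (length zs). dist (ws ! i) ((t # zs) ! i) < \<delta>) \<longrightarrow> dist (F ws) (F (t # zs)) < \<epsilon> / 2"
    if t: "t \<in> K" for t
  proof -
    obtain \<delta> where "\<delta> > 0" "\<And>ws. length ws = Suc (length zs) \<Longrightarrow> set ws \<subseteq> U \<Longrightarrow>
      (\<And>i. i < Suc (length zs) \<Longrightarrow> dist (ws ! i) ((t # zs) ! i) < \<delta>) \<Longrightarrow>
      dist (F ws) (F (t # zs)) < \<epsilon> / 2"
      by (rule multi_holomorphic_continuous[OF F, of "t # zs" "\<epsilon> / 2"])
        (use t K(2) zs \<open>\<epsilon> > 0\<close> in auto)
    then show ?thesis by blast
  qed
  then obtain d where d: "\<And>t. t \<in> K \<Longrightarrow> d t > 0"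
    "\<forall>t\<in>K. \<forall>ws. length ws = Suc (length zs) \<longrightarrow> set ws \<subseteq> U \<longrightarrow>
    (\<forall>i<Suc (length zs). dist (ws ! i) ((t # zs) ! i) < d t) \<longrightarrow> dist (F ws) (F (t # zs)) < \<epsilon> / 2"
    by (metis (no_types))
  have "K \<subseteq> (\<Union>t\<in>K. ball t (d t))" using d(1) by force
  with K(1) obtain C where C: "C \<subseteq> K" "finite C" "K \<subseteq> (\<Union>t\<in>C. ball t (d t))"
    by (elim compactE_image[where C = K and f = "\<lambda>t. ball t (d t)"]) auto
  \<comment> \<open>Inserting 1 keeps the minimum meaningful when \<open>K\<close>, and with it
    \<open>C\<close>, is empty.\<close>
  define \<delta> where "\<delta> = Min (insert 1 (d ` C))"
  have \<delta>: "\<delta> > 0" "\<And>t. t \<in> C \<Longrightarrow> \<delta> \<le> d t"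
    using C d(1) by (auto simp: \<delta>_def)
  show ?thesis
  proof (rule that[OF \<delta>(1)])
    fix t ws assume t: "t \<in> K" and ws: "length ws = length zs" "set ws \<subseteq> U"
      "\<And>i. i < length zs \<Longrightarrow> dist (ws ! i) (zs ! i) < \<delta>"
    from t C obtain c where c: "c \<in> C" "dist c t < d c" by force
    then have "c \<in> K" using C by blast
    have "dist (F (t # ws)) (F (c # zs)) < \<epsilon> / 2"
    proof (rule d(2)[rule_format, OF \<open>c \<in> K\<close>])
      fix i assume "i < Suc (length zs)"
      then show "dist ((t # ws) ! i) ((c # zs) ! i) < d c"
        using c ws(3)[of "i - 1"] \<delta>(2)[OF c(1)] by (cases i) (auto simp: dist_commute)
    qed (use ws t K in auto)
    moreover have "dist (F (t # zs)) (F (c # zs)) < \<epsilon> / 2"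
    proof (rule d(2)[rule_format, OF \<open>c \<in> K\<close>])
      fix i assume "i < Suc (length zs)"
      then show "dist ((t # zs) ! i) ((c # zs) ! i) < d c"
        using c d(1)[OF \<open>c \<in> K\<close>] by (cases i) (auto simp: dist_commute)
    qed (use zs t K in auto)
    ultimately show "dist (F (t # ws)) (F (t # zs)) < \<epsilon>"
      by (metis dist_triangle_half_l)
  qed
qed

text \<open>The difference quotients in the first variable are holomorphic in the second and
  converge locally uniformly, by uniform continuity of \<open>D\<close> on a compact product of
  discs; a locally uniform limit of holomorphic functions is holomorphic.\<close>

lemma holomorphic_on_partial_deriv:
  fixes G D :: "complex \<Rightarrow> complex \<Rightarrow> complex"
  assumes U: "open U" and z: "z \<in> U"
    and cont: "continuous_on (U \<times> U) (\<lambda>(t, u). D t u)"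
    and D: "\<And>t u. t \<in> U \<Longrightarrow> u \<in> U \<Longrightarrow> ((\<lambda>t. G t u) has_field_derivative D t u) (at t)"
    and G: "\<And>t. t \<in> U \<Longrightarrow> G t holomorphic_on U"
  shows "D z holomorphic_on U"
proof -
  obtain r where r: "r > 0" "cball z r \<subseteq> U" using U z open_contains_cball by blast
  have "D z field_differentiable at u" if u: "u \<in> U" for u
  proof -
    obtain s where s: "s > 0" "cball u s \<subseteq> U" using U u open_contains_cball by blast
    define K where "K = cball z r \<times> cball u s"
    have "compact K" by (auto simp: K_def intro: compact_Times)
    moreover have "K \<subseteq> U \<times> U" using r s by (auto simp: K_def)
    ultimately have uc: "uniformly_continuous_on K (\<lambda>(t, u). D t u)"
      using cont continuous_on_subset compact_uniformly_continuous by blast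
    define f where "f = (\<lambda>h v. (G (z + h) v - G z v) / h)"
    have ul: "uniform_limit (cball u s) f (D z) (at 0)"
    proof (rule uniform_limitI)
      fix e :: real assume e: "e > 0"
      then have "e / 2 > 0" by simp
      with uc obtain d where d: "d > 0" "\<forall>y\<in>K. \<forall>x\<in>K. dist x y < d \<longrightarrow>
          dist (case_prod D x) (case_prod D y) < e / 2"
        unfolding uniformly_continuous_on_def by blast
      have "eventually (\<lambda>h::complex. h \<in> ball 0 (min d r) \<and> h \<noteq> 0) (at 0)"
        using eventually_at_ball'[of "min d r" "0::complex" UNIV] d r by simp
      then show "\<forall>\<^sub>F h in at 0. \<forall>v\<in>cball u s. dist (f h v) (D z v) < e"
      proof eventually_elim
        case (elim h)
        show ?case
        proof
          fix v assume v: "v \<in> cball u s"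
          \<comment> \<open>Subtracting the linear function with slope \<open>D z v\<close> leaves a
            derivative of size at most \<open>e / 2\<close>, so the mean value bound controls the
            error of the difference quotient uniformly in \<open>v\<close>.\<close>
          have "norm ((G (z + h) v - D z v * (z + h)) - (G z v - D z v * z)) \<le> e / 2 * norm ((z + h) - z)"
          proof (rule field_differentiable_bound[where S = "ball z (min d r)"])
            fix t assume t: "t \<in> ball z (min d r)"
            then have tU: "t \<in> U" "v \<in> U" using r s v by auto
            show "((\<lambda>t. G t v - D z v * t) has_field_derivative D t v - D z v) (at t within ball z (min d r))"
              by (rule derivative_eq_intros has_field_derivative_at_within[OF D[OF tU]] refl | simp)+
            have "dist (t, v) (z, v) < d" using t by (simp add: dist_prod_def dist_commute)
            then show "norm (D t v - D z v) \<le> e / 2"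
              using d(2)[rule_format, of "(z, v)" "(t, v)"] t v r
              by (simp add: K_def dist_norm less_imp_le)
          qed (use elim d r in \<open>auto simp: dist_norm\<close>)
          moreover have "(G (z + h) v - D z v * (z + h)) - (G z v - D z v * z) = h * (f h v - D z v)"
            using elim by (simp add: f_def field_simps)
          ultimately have "norm (h * (f h v - D z v)) \<le> e / 2 * norm h"
            by simp
          then have "norm (f h v - D z v) \<le> e / 2"
            using elim by (simp add: norm_mult mult.commute)
          then show "dist (f h v) (D z v) < e" using e by (simp add: dist_norm)
        qed
      qed
    qed
    have ev: "eventually (\<lambda>h. continuous_on (cball u s) (f h) \<and> f h holomorphic_on ball u s) (at 0)"
    proof -
      have "eventually (\<lambda>h::complex. h \<in> ball 0 r \<and> h \<noteq> 0) (at 0)"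
        using eventually_at_ball'[of r "0::complex" UNIV] r by simp
      then show ?thesis
      proof eventually_elim
        case (elim h)
        then have "z + h \<in> U" using r by (auto simp: dist_norm)
        then have "f h holomorphic_on U" using elim z unfolding f_def
          by (intro holomorphic_intros G) auto
        then show ?case using s holomorphic_on_imp_continuous_on
          by (metis ball_subset_cball holomorphic_on_subset)
      qed
    qed
    have "D z holomorphic_on ball u s"
      by (rule holomorphic_uniform_limit[OF ev ul trivial_limit_at])
    then show ?thesis using s by (auto simp: holomorphic_on_open field_differentiable_def)
  qed
  then show ?thesis by (simp add: field_differentiable_at_within holomorphic_on_def)
qed

text \<open>Taking a list again, rather than a separated first argument, lets
  \<open>multi_holomorphic\<close> and the diagonal lemmas be applied to the derivative
  itself.\<close>

definition deriv_head :: "(complex list \<Rightarrow> complex) \<Rightarrow> complex list \<Rightarrow> complex" where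
  "deriv_head F zs = deriv (\<lambda>u. F (u # tl zs)) (hd zs)"

lemma deriv_head_Cons [simp]: "deriv_head F (z # zs) = deriv (\<lambda>u. F (u # zs)) z"
  by (simp add: deriv_head_def)

text \<open>Moving the tail from \<open>zs\<close> to \<open>ws\<close> changes \<open>F\<close>
  little, uniformly in the first variable on a disc, hence by Cauchy's inequality also changes its
  derivative little. Moving the first variable uses continuity of the derivative of one holomorphic
  function.\<close>

lemma deriv_head_continuous:
  assumes F: "multi_holomorphic U (Suc (length zs)) F" and U: "open U" "z \<in> U" "set zs \<subseteq> U"
    and e: "e > 0"
  shows "\<exists>\<delta>>0. \<forall>w ws. length ws = length zs \<and> set ws \<subseteq> U \<and> dist w z < \<delta> \<and>
           (\<forall>i<length zs. dist (ws ! i) (zs ! i) < \<delta>) \<longrightarrow>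
           dist (deriv_head F (w # ws)) (deriv_head F (z # zs)) < e"
proof -
  \<comment> \<open>The disc has radius \<open>2 * r\<close> so that the Cauchy circles of radius
    \<open>r\<close> about points \<open>w\<close> near \<open>z\<close> stay inside it.\<close>
  obtain r where r: "r > 0" "cball z (2 * r) \<subseteq> U"
    using U open_contains_cball by (metis field_sum_of_halves half_gt_zero mult_2)
  obtain d where d: "d > 0" "\<And>t ws. t \<in> cball z (2 * r) \<Longrightarrow> length ws = length zs \<Longrightarrow> set ws \<subseteq> U \<Longrightarrow>
    (\<And>i. i < length zs \<Longrightarrow> dist (ws ! i) (zs ! i) < d) \<Longrightarrow> dist (F (t # ws)) (F (t # zs)) < e / 2 * r"
    using multi_holomorphic_uniform[OF F U(3), of "cball z (2 * r)" "e / 2 * r"] r e by auto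
  have hol: "(\<lambda>u. F (u # ws)) holomorphic_on U" if "length ws = length zs" "set ws \<subseteq> U" for ws
    using multi_holomorphic_Cons[OF F] that by simp
  have "isCont (deriv (\<lambda>u. F (u # zs))) z"
    using holomorphic_on_imp_continuous_on[OF holomorphic_deriv[OF hol[of zs] U(1)]] U
    by (simp add: continuous_on_eq_continuous_at)
  then obtain d' where d': "d' > 0" "\<And>w. dist w z < d' \<Longrightarrow>
      dist (deriv (\<lambda>u. F (u # zs)) w) (deriv (\<lambda>u. F (u # zs)) z) < e / 2"
    using e unfolding continuous_at_eps_delta by (meson half_gt_zero)
  define \<delta> where "\<delta> = min (min d d') r"
  have "dist (deriv_head F (w # ws)) (deriv_head F (z # zs)) < e"
    if ws: "length ws = length zs" "set ws \<subseteq> U" "dist w z < \<delta>"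
      "\<And>i. i < length zs \<Longrightarrow> dist (ws ! i) (zs ! i) < \<delta>" for w ws
  proof -
    have w: "w \<in> U" "cball w r \<subseteq> cball z (2 * r)" "cball w r \<subseteq> U"
    proof -
      show *: "cball w r \<subseteq> cball z (2 * r)"
        using ws(3) by (intro cball_subset_cball_iff[THEN iffD2] disjI1) (auto simp: \<delta>_def)
      show "cball w r \<subseteq> U" using * r by blast
      then show "w \<in> U" using r by auto
    qed
    define g where "g = (\<lambda>u. F (u # ws) - F (u # zs))"
    have g: "g holomorphic_on U" unfolding g_def using ws U by (intro holomorphic_intros hol) auto
    \<comment> \<open>The bound \<open>e / 2 * r\<close> on the circle was chosen to leave
      \<open>e / 2\<close> after division by \<open>r\<close>.\<close>
    have "norm ((deriv ^^ 1) g w) \<le> fact 1 * (e / 2 * r) / r ^ 1"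
    proof (rule Cauchy_inequality)
      show "g holomorphic_on ball w r" using g w by (meson ball_subset_cball holomorphic_on_subset)
      show "continuous_on (cball w r) g"
        using g w by (meson holomorphic_on_subset holomorphic_on_imp_continuous_on)
      fix t assume "norm (w - t) = r"
      then have "t \<in> cball w r" by (simp add: dist_norm)
      then have "t \<in> cball z (2 * r)" using w by blast
      from d(2)[OF this ws(1,2)] ws(4) show "norm (g t) \<le> e / 2 * r"
        by (auto simp: g_def dist_norm \<delta>_def less_imp_le)
    qed (use r in auto)
    then have 1: "norm (deriv g w) \<le> e / 2" using r by simp
    have "deriv g w = deriv (\<lambda>u. F (u # ws)) w - deriv (\<lambda>u. F (u # zs)) w"
      unfolding g_def using hol ws U w
      by (intro deriv_diff holomorphic_on_imp_differentiable_at[of _ U]) auto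
    with 1 have "dist (deriv (\<lambda>u. F (u # ws)) w) (deriv (\<lambda>u. F (u # zs)) w) \<le> e / 2"
      by (simp add: dist_norm)
    moreover have "dist (deriv (\<lambda>u. F (u # zs)) w) (deriv (\<lambda>u. F (u # zs)) z) < e / 2"
      using d'(2) ws(3) by (simp add: \<delta>_def)
    ultimately show ?thesis
      using dist_triangle[of "deriv (\<lambda>u. F (u # ws)) w" "deriv (\<lambda>u. F (u # zs)) z"
          "deriv (\<lambda>u. F (u # zs)) w"] by simp
  qed
  moreover have "\<delta> > 0" using d d' r by (simp add: \<delta>_def)
  ultimately show ?thesis by blast
qed

text \<open>Joint continuity comes from the Cauchy estimate. Holomorphy in the head is that of a
  derivative; in any other slot it is the holomorphy of a partial derivative with respect to a
  parameter.\<close>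

lemma multi_holomorphic_deriv_head:
  assumes F: "multi_holomorphic U (Suc m) F" and U: "open U"
  shows "multi_holomorphic U (Suc m) (deriv_head F)"
  unfolding multi_holomorphic_def
proof (intro allI impI conjI, goal_cases)
  case (1 zs i)
  then obtain z xs where zs: "zs = z # xs" "length xs = m" "z \<in> U" "set xs \<subseteq> U"
    by (cases zs) auto
  show ?case
  proof (cases i)
    case 0
    then show ?thesis
      using holomorphic_deriv[OF multi_holomorphic_Cons[OF F] U] zs by simp
  next
    case (Suc j)
    then have j: "j < m" using 1 by simp
    have sub: "set (xs[j := u]) \<subseteq> U" if "u \<in> U" for u
      using that zs set_update_subset_insert by fastforce
    have "(\<lambda>t u. deriv_head F (t # xs[j := u])) z holomorphic_on U"
    proof (rule holomorphic_on_partial_deriv[OF U zs(3), where G = "\<lambda>t u. F (t # xs[j := u])"])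
      show "continuous_on (U \<times> U) (\<lambda>(t, u). deriv_head F (t # xs[j := u]))"
        unfolding continuous_on_iff
      proof (safe, goal_cases)
        case (1 t u e)
        obtain \<delta> where \<delta>: "\<delta> > 0" "\<And>w ws. length ws = m \<and> set ws \<subseteq> U \<and> dist w t < \<delta> \<and>
           (\<forall>i<m. dist (ws ! i) (xs[j := u] ! i) < \<delta>) \<Longrightarrow>
           dist (deriv_head F (w # ws)) (deriv_head F (t # xs[j := u])) < e"
          using deriv_head_continuous[of U "xs[j := u]" F t e] F U sub 1 zs by auto
        have "dist (deriv_head F (t' # xs[j := u'])) (deriv_head F (t # xs[j := u])) < e"
          if "t' \<in> U" "u' \<in> U" "dist (t', u') (t, u) < \<delta>" for t' u'
        proof (rule \<delta>(2), intro conjI allI impI)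
          have *: "dist t' t \<le> dist (t', u') (t, u)" "dist u' u \<le> dist (t', u') (t, u)"
            using dist_fst_le[of "(t', u')" "(t, u)"] dist_snd_le[of "(t', u')" "(t, u)"] by auto
          show "dist t' t < \<delta>" using * that by linarith
          fix i assume "i < m"
          then show "dist (xs[j := u'] ! i) (xs[j := u] ! i) < \<delta>"
            using * that \<delta>(1) zs j by (cases "i = j") auto
        qed (use that sub zs in auto)
        then show ?case using \<delta>(1) by fastforce
      qed
      fix t u assume tu: "t \<in> U" "u \<in> U"
      show "((\<lambda>t. F (t # xs[j := u])) has_field_derivative deriv_head F (t # xs[j := u])) (at t)"
        using multi_holomorphic_Cons[OF F, of "xs[j := u]"] U sub zs tu
        by (simp add: holomorphic_derivI)
    next
      fix t assume t: "t \<in> U"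
      show "(\<lambda>u. F (t # xs[j := u])) holomorphic_on U"
        using multi_holomorphic_holomorphic[OF F, of "t # xs" "Suc j"] zs j t by simp
    qed
    then show ?thesis using Suc zs by simp
  qed
next
  case (2 zs \<epsilon>)
  then obtain z xs where zs: "zs = z # xs" "length xs = m" "z \<in> U" "set xs \<subseteq> U"
    by (cases zs) auto
  from deriv_head_continuous[of U xs F z \<epsilon>] F U zs 2
  obtain \<delta> where \<delta>: "\<delta> > 0" "\<And>w ws. length ws = m \<and> set ws \<subseteq> U \<and> dist w z < \<delta> \<and>
           (\<forall>i<m. dist (ws ! i) (xs ! i) < \<delta>) \<Longrightarrow>
           dist (deriv_head F (w # ws)) (deriv_head F (z # xs)) < \<epsilon>" by auto
  have "dist (deriv_head F ws) (deriv_head F zs) < \<epsilon>"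
    if len: "length ws = Suc m" and "set ws \<subseteq> U"
      and close: "\<And>i. i < Suc m \<Longrightarrow> dist (ws ! i) (zs ! i) < \<delta>" for ws
  proof -
    obtain w vs where ws: "ws = w # vs" using len by (cases ws) auto
    show ?thesis unfolding ws zs
    proof (rule \<delta>(2), intro conjI allI impI)
      show "dist w z < \<delta>" using close[of 0] ws zs by simp
      fix i assume "i < m"
      then show "dist (vs ! i) (xs ! i) < \<delta>" using close[of "Suc i"] ws zs by simp
    qed (use that ws in auto)
  qed
  then show ?case using \<delta>(1) by blast
qed

section \<open>Differentiation along the diagonal\<close>

lemma deriv_cong_open:
  fixes f g :: "complex \<Rightarrow> complex"
  assumes "open U" "z \<in> U" "\<And>u. u \<in> U \<Longrightarrow> f u = g u"
  shows "deriv f z = deriv g z"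
  using assms by (intro deriv_cong_ev) (auto simp: eventually_nhds)

text \<open>Split the increment into \<open>G s s - G w s\<close> and \<open>G w s - G w w\<close>.
  The second is an ordinary derivative; in the first the parameter moves along with the variable, so
  continuity of the partial derivative is needed.\<close>

lemma has_field_derivative_diagonal:
  fixes G :: "complex \<Rightarrow> complex \<Rightarrow> complex"
  assumes G: "multi_holomorphic U 2 (\<lambda>xs. G (xs ! 0) (xs ! 1))" and U: "open U" "w \<in> U"
  shows "((\<lambda>s. G s s) has_field_derivative deriv (\<lambda>t. G t w) w + deriv (\<lambda>t. G w t) w) (at w)"
proof -
  have G': "multi_holomorphic U (Suc (length [w])) (\<lambda>xs. G (xs ! 0) (xs ! 1))"
    using G by (simp add: numeral_2_eq_2)
  have hol1: "(\<lambda>t. G t s) holomorphic_on U" if "s \<in> U" for s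
    using multi_holomorphic_Cons[OF G, of "[s]"] that by simp
  have hol2: "G w holomorphic_on U"
    using multi_holomorphic_append[OF G, of "[w]" "[]"] U by simp
  have "((\<lambda>s. (G s s - G w s) / (s - w)) \<longlongrightarrow> deriv (\<lambda>t. G t w) w) (at w)"
  proof (rule tendstoI)
    fix e :: real assume e: "e > 0"
    obtain r where r: "r > 0" "ball w r \<subseteq> U" using U open_contains_ball by blast
    obtain d where d: "d > 0" "\<And>x xs. length xs = 1 \<and> set xs \<subseteq> U \<and> dist x w < d \<and> dist (xs ! 0) w < d \<Longrightarrow>
        dist (deriv (\<lambda>u. G u (xs ! 0)) x) (deriv (\<lambda>u. G u w) w) < e / 2"
      using deriv_head_continuous[OF G', of w "e / 2"] U e by auto
    have "eventually (\<lambda>s. s \<in> ball w (min r d) \<and> s \<noteq> w) (at w)"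
      using eventually_at_ball'[of "min r d" w UNIV] d r by simp
    then show "\<forall>\<^sub>F s in at w. dist ((G s s - G w s) / (s - w)) (deriv (\<lambda>t. G t w) w) < e"
    proof eventually_elim
      case (elim s)
      define c where "c = deriv (\<lambda>t. G t w) w"
      have sU: "s \<in> U" using elim r by auto
      have "norm ((G s s - c * s) - (G w s - c * w)) \<le> e / 2 * norm (s - w)"
      proof (rule field_differentiable_bound[where S = "ball w (min r d)"
            and f' = "\<lambda>t. deriv (\<lambda>u. G u s) t - c"])
        fix t assume t: "t \<in> ball w (min r d)"
        then have tU: "t \<in> U" using r by auto
        show "((\<lambda>t. G t s - c * t) has_field_derivative deriv (\<lambda>u. G u s) t - c) (at t within ball w (min r d))"
          by (rule derivative_eq_intros has_field_derivative_at_within[OF holomorphic_derivI[OF hol1[OF sU] U(1) tU]] refl | simp)+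
        show "norm (deriv (\<lambda>u. G u s) t - c) \<le> e / 2"
          using d(2)[of "[s]" t] t elim sU by (simp add: dist_norm c_def norm_minus_commute)
      qed (use elim r d in auto)
      moreover have "(G s s - c * s) - (G w s - c * w) = (s - w) * ((G s s - G w s) / (s - w) - c)"
        using elim by (simp add: field_simps)
      ultimately have "norm ((G s s - G w s) / (s - w) - c) \<le> e / 2"
        using elim by (simp only: norm_mult) (simp add: mult.commute)
      then show ?case using e by (simp add: dist_norm c_def)
    qed
  qed
  moreover have "((\<lambda>s. (G w s - G w w) / (s - w)) \<longlongrightarrow> deriv (G w) w) (at w)"
    using holomorphic_derivI[OF hol2 U] by (simp add: has_field_derivative_iff)
  ultimately have "((\<lambda>s. (G s s - G w s) / (s - w) + (G w s - G w w) / (s - w)) \<longlongrightarrow>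
      deriv (\<lambda>t. G t w) w + deriv (G w) w) (at w)"
    by (rule tendsto_add)
  then show ?thesis
    by (simp add: has_field_derivative_iff flip: add_divide_distrib)
qed

text \<open>Induction on the number of coinciding variables: the first \<open>k\<close> copies are
  treated as one variable and the last copy as another, which reduces to two variables. The tail
  \<open>v\<close> is arbitrary because it absorbs the split-off copy.\<close>

lemma has_field_derivative_replicate:
  assumes F: "multi_holomorphic U n F" and U: "open U" "z \<in> U"
    and v: "n = k + length v" "set v \<subseteq> U"
  shows "((\<lambda>z. F (replicate k z @ v)) has_field_derivative
           (\<Sum>i<k. deriv (\<lambda>u. F (replicate i z @ u # replicate (k - Suc i) z @ v)) z)) (at z)"
  using v U(2)
proof (induction k arbitrary: v z)
  case 0
  then show ?case by simp
next
  case (Suc k)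
  define G where "G = (\<lambda>s u. F (replicate k s @ u # v))"
  have "multi_holomorphic U 2 (\<lambda>xs. G (xs ! 0) (xs ! 1))"
    unfolding multi_holomorphic_def
  proof (intro allI impI conjI, goal_cases)
    case (1 xs i)
    then obtain a b where ab: "xs = [a, b]" "a \<in> U" "b \<in> U"
      by (auto simp: length_Suc_conv numeral_2_eq_2)
    have "(\<lambda>s. G s b) holomorphic_on U"
      using Suc.IH[of "b # v"] Suc.prems ab U(1) by (auto simp: G_def holomorphic_on_open)
    moreover have "(\<lambda>u. G a u) holomorphic_on U"
      unfolding G_def using Suc.prems ab by (intro multi_holomorphic_append[OF F]) auto
    moreover have "i = 0 \<or> i = 1" using 1 by auto
    ultimately show ?case using ab by auto
  next
    case (2 xs \<epsilon>)
    then obtain a b where ab: "xs = [a, b]" "a \<in> U" "b \<in> U"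
      by (auto simp: length_Suc_conv numeral_2_eq_2)
    obtain \<delta> where \<delta>: "\<delta> > 0" "\<And>ws. length ws = n \<Longrightarrow> set ws \<subseteq> U \<Longrightarrow>
      (\<And>i. i < n \<Longrightarrow> dist (ws ! i) ((replicate k a @ b # v) ! i) < \<delta>) \<Longrightarrow>
      dist (F ws) (F (replicate k a @ b # v)) < \<epsilon>"
      by (rule multi_holomorphic_continuous[OF F, of "replicate k a @ b # v" \<epsilon>])
        (use ab Suc.prems 2 in auto)
    have "dist (G (ws ! 0) (ws ! 1)) (G (xs ! 0) (xs ! 1)) < \<epsilon>"
      if ws: "length ws = 2" "set ws \<subseteq> U" "\<And>i. i < 2 \<Longrightarrow> dist (ws ! i) (xs ! i) < \<delta>" for ws
    proof -
      obtain c d where cd: "ws = [c, d]"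
        using ws(1) by (auto simp: length_Suc_conv numeral_2_eq_2)
      have "dist c a < \<delta>" "dist d b < \<delta>" using ws(3)[of 0] ws(3)[of 1] ab cd by auto
      then have "dist (F (replicate k c @ d # v)) (F (replicate k a @ b # v)) < \<epsilon>"
        using ws(2) cd Suc.prems \<delta>(1)
        by (intro \<delta>(2)) (auto simp: nth_append nth_Cons split: nat.splits)
      then show ?thesis using ab cd by (simp add: G_def)
    qed
    then show ?case using \<delta>(1) by blast
  qed
  from has_field_derivative_diagonal[OF this U(1) Suc.prems(3)]
  have D: "((\<lambda>s. G s s) has_field_derivative deriv (\<lambda>t. G t z) z + deriv (\<lambda>t. G z t) z) (at z)" .
  have eq: "replicate m z @ z # v = replicate (Suc m) z @ v" for m z
    by (simp add: replicate_app_Cons_same)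
  have "deriv (\<lambda>t. G t z) z =
      (\<Sum>i<k. deriv (\<lambda>u. F (replicate i z @ u # replicate (k - Suc i) z @ z # v)) z)"
    unfolding G_def using Suc.IH[of "z # v" z] Suc.prems by (intro DERIV_imp_deriv) auto
  also have "\<dots> = (\<Sum>i<k. deriv (\<lambda>u. F (replicate i z @ u # replicate (Suc k - Suc i) z @ v)) z)"
    unfolding eq by (intro sum.cong refl) (simp add: Suc_diff_Suc)
  finally have *: "deriv (\<lambda>t. G t z) z = \<dots>" .
  have "(\<lambda>s. G s s) = (\<lambda>z. F (replicate (Suc k) z @ v))" by (simp add: G_def eq)
  moreover have "deriv (\<lambda>t. G t z) z + deriv (\<lambda>t. G z t) z =
      (\<Sum>i<Suc k. deriv (\<lambda>u. F (replicate i z @ u # replicate (Suc k - Suc i) z @ v)) z)"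
    unfolding * by (simp add: G_def)
  ultimately show ?case using D by simp
qed

text \<open>By symmetry each of the \<open>Suc m\<close> slots contributes the derivative in the
  head.\<close>

lemma has_field_derivative_replicate_symmetric:
  assumes F: "multi_holomorphic U (Suc m) F" "multi_symmetric U (Suc m) F" and U: "open U" "z \<in> U"
  shows "((\<lambda>z. F (replicate (Suc m) z)) has_field_derivative
           of_nat (Suc m) * deriv_head F (replicate (Suc m) z)) (at z)"
proof -
  have "deriv (\<lambda>u. F (replicate i z @ u # replicate (m - i) z)) z =
      deriv (\<lambda>u. F (u # replicate m z)) z" if "i \<le> m" for i
  proof (rule deriv_cong_open[OF U])
    fix u assume u: "u \<in> U"
    have "replicate m z = replicate i z @ replicate (m - i) z"
      using that by (simp flip: replicate_add)
    then show "F (replicate i z @ u # replicate (m - i) z) = F (u # replicate m z)"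
      using U u that by (intro multi_symmetricD[OF F(2)]) auto
  qed
  then have "(\<Sum>i<Suc m. deriv (\<lambda>u. F (replicate i z @ u # replicate (Suc m - Suc i) z @ [])) z) =
      (\<Sum>i<Suc m. deriv (\<lambda>u. F (u # replicate m z)) z)"
    by (intro sum.cong refl) auto
  then show ?thesis
    using has_field_derivative_replicate[OF F(1) U, of "Suc m" "[]"] by simp
qed

text \<open>After one differentiation only the last \<open>m\<close> slots are still
  interchangeable: the head gives the pure second derivative, each other slot the same mixed one.
  For \<open>m = 0\<close> the list in the mixed term has the wrong length, but its factor is
  0.\<close>

lemma has_field_derivative_deriv_head_replicate:
  assumes F: "multi_holomorphic U (Suc m) F" "multi_symmetric U (Suc m) F" and U: "open U" "z \<in> U"
  shows "((\<lambda>z. deriv_head F (replicate (Suc m) z)) has_field_derivative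
           deriv (\<lambda>u. deriv_head F (u # replicate m z)) z +
           of_nat m * deriv (\<lambda>u1. deriv (\<lambda>u2. F (u1 # u2 # replicate (m - 1) z)) z) z) (at z)"
proof -
  have 1: "deriv (\<lambda>u. deriv_head F (replicate (Suc j) z @ u # replicate (m - Suc j) z)) z =
      deriv (\<lambda>u1. deriv (\<lambda>u2. F (u1 # u2 # replicate (m - 1) z)) z) z" if "j < m" for j
  proof (rule deriv_cong_open[OF U])
    fix u assume u: "u \<in> U"
    have "deriv (\<lambda>t. F (t # replicate j z @ u # replicate (m - Suc j) z)) z =
       deriv (\<lambda>t. F (u # t # replicate (m - 1) z)) z"
    proof (rule deriv_cong_open[OF U])
      fix t assume t: "t \<in> U"
      have "replicate (m - 1) z = replicate j z @ replicate (m - Suc j) z"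
        using that by (simp flip: replicate_add)
      then show "F (t # replicate j z @ u # replicate (m - Suc j) z) = F (u # t # replicate (m - 1) z)"
        using U u t that by (intro multi_symmetricD[OF F(2)]) auto
    qed
    then show "deriv_head F (replicate (Suc j) z @ u # replicate (m - Suc j) z) =
        deriv (\<lambda>u2. F (u # u2 # replicate (m - 1) z)) z" by simp
  qed
  have "((\<lambda>z. deriv_head F (replicate (Suc m) z)) has_field_derivative
      (\<Sum>i<Suc m. deriv (\<lambda>u. deriv_head F (replicate i z @ u # replicate (m - i) z)) z)) (at z)"
    using has_field_derivative_replicate[OF multi_holomorphic_deriv_head[OF F(1) U(1)] U, of "Suc m" "[]"]
    by simp
  also have "(\<Sum>i<Suc m. deriv (\<lambda>u. deriv_head F (replicate i z @ u # replicate (m - i) z)) z) =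
      deriv (\<lambda>u. deriv_head F (u # replicate m z)) z +
      (\<Sum>j<m. deriv (\<lambda>u. deriv_head F (replicate (Suc j) z @ u # replicate (m - Suc j) z)) z)"
    by (subst sum.lessThan_Suc_shift) simp
  also have "(\<Sum>j<m. deriv (\<lambda>u. deriv_head F (replicate (Suc j) z @ u # replicate (m - Suc j) z)) z) =
      of_nat m * deriv (\<lambda>u1. deriv (\<lambda>u2. F (u1 # u2 # replicate (m - 1) z)) z) z"
    using 1 by simp
  finally show ?thesis .
qed

section \<open>The PDE recursion on the diagonal\<close>

text \<open>Once all variables coincide, a splitting matters only through the cardinality of its
  blocks.\<close>

lemma nths_replicate_subset:
  assumes "I \<subseteq> {..<m}"
  shows "nths (replicate m w) I = replicate (card I) w"
proof -
  have "{i. i < m \<and> i \<in> I} = I" using assms by auto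
  then have "length (nths (replicate m w) I) = card I"
    by (simp add: length_nths)
  moreover have "set (nths (replicate m w) I) \<subseteq> {w}"
    using set_nths_subset[of "replicate m w" I] by (auto split: if_splits)
  ultimately show ?thesis
    by (intro replicate_eqI) auto
qed

text \<open>The genus-lowering term of the recursion differentiates the second slot inside and the
  first outside. Symmetry turns the inner one into a \<open>deriv_head\<close>, whose regularity is
  known. The second claim is the continuity needed to let \<open>z1\<close> tend to
  \<open>w\<close>.\<close>

lemma mixed_deriv_symmetric:
  assumes F: "multi_holomorphic U (Suc (Suc (length zs))) F" "multi_symmetric U (Suc (Suc (length zs))) F"
    and U: "open U" "set zs \<subseteq> U"
  shows "z \<in> U \<Longrightarrow> (\<lambda>u1. deriv (\<lambda>u2. F (u1 # u2 # zs)) z) holomorphic_on U"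
    and "w \<in> U \<Longrightarrow> ((\<lambda>z. deriv (\<lambda>u1. deriv (\<lambda>u2. F (u1 # u2 # zs)) z) z) \<longlongrightarrow>
           deriv (\<lambda>u1. deriv (\<lambda>u2. F (u1 # u2 # zs)) w) w) (at w)"
proof -
  let ?H = "\<lambda>z u1. deriv (\<lambda>u2. F (u1 # u2 # zs)) z"
  have D: "multi_holomorphic U (Suc (Suc (length zs))) (deriv_head F)"
    by (rule multi_holomorphic_deriv_head[OF F(1) U(1)])
  have swap: "?H z u = deriv_head F (z # u # zs)" if "z \<in> U" "u \<in> U" for z u
    unfolding deriv_head_Cons using that U F(2)
    by (intro deriv_cong_open[OF U(1)] multi_symmetricD[OF F(2)]) auto
  show hol: "?H z holomorphic_on U" if "z \<in> U" for z
  proof -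
    have "(\<lambda>u. deriv_head F (z # u # zs)) holomorphic_on U"
      using multi_holomorphic_append[OF D, of "[z]" zs] that U by simp
    then show ?thesis using swap that by (simp cong: holomorphic_cong)
  qed
  \<comment> \<open>The two leading slots are exchanged so that the outer derivative is again a
    \<open>deriv_head\<close>, now of \<open>L\<close>, with the inner evaluation point frozen in
    the second slot.\<close>
  define L where "L = (\<lambda>xs. deriv_head F (xs ! 1 # xs ! 0 # zs))"
  have L: "multi_holomorphic U (Suc (Suc 0)) L"
    unfolding multi_holomorphic_def
  proof (intro allI impI conjI, goal_cases)
    case (1 xs i)
    then obtain a b where ab: "xs = [a, b]" "a \<in> U" "b \<in> U"
      by (auto simp: length_Suc_conv)
    have "(\<lambda>s. deriv_head F (s # a # zs)) holomorphic_on U"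
      using multi_holomorphic_Cons[OF D, of "a # zs"] ab U by simp
    moreover have "(\<lambda>u. deriv_head F (b # u # zs)) holomorphic_on U"
      using multi_holomorphic_append[OF D, of "[b]" zs] ab U by simp
    moreover have "i = 0 \<or> i = 1" using 1 by auto
    ultimately show ?case using ab unfolding L_def by auto
  next
    case (2 xs \<epsilon>)
    then obtain a b where ab: "xs = [a, b]" "a \<in> U" "b \<in> U"
      by (auto simp: length_Suc_conv)
    obtain \<delta> where \<delta>: "\<delta> > 0" "\<And>ws. length ws = Suc (Suc (length zs)) \<Longrightarrow> set ws \<subseteq> U \<Longrightarrow>
      (\<And>i. i < Suc (Suc (length zs)) \<Longrightarrow> dist (ws ! i) ((b # a # zs) ! i) < \<delta>) \<Longrightarrow>
      dist (deriv_head F ws) (deriv_head F (b # a # zs)) < \<epsilon>"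
      by (rule multi_holomorphic_continuous[OF D, of "b # a # zs" \<epsilon>]) (use ab U 2 in auto)
    have "dist (L ws) (L xs) < \<epsilon>"
      if ws: "length ws = Suc (Suc 0)" "set ws \<subseteq> U" "\<And>i. i < Suc (Suc 0) \<Longrightarrow> dist (ws ! i) (xs ! i) < \<delta>" for ws
    proof -
      obtain c d where cd: "ws = [c, d]" using ws(1) by (auto simp: length_Suc_conv)
      have "dist c a < \<delta>" "dist d b < \<delta>" using ws(3)[of 0] ws(3)[of 1] ab cd by auto
      then have "dist (deriv_head F (d # c # zs)) (deriv_head F (b # a # zs)) < \<epsilon>"
        using ws(2) cd U \<delta>(1)
        by (intro \<delta>(2)) (auto simp: nth_Cons simp del: deriv_head_Cons split: nat.splits)
      then show ?thesis using ab cd by (simp add: L_def del: deriv_head_Cons)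
    qed
    then show ?case using \<delta>(1) by blast
  qed
  show "((\<lambda>z. deriv (?H z) z) \<longlongrightarrow> deriv (?H w) w) (at w)" if w: "w \<in> U"
  proof -
    have eq: "deriv (?H z) z = deriv_head L [z, z]" if "z \<in> U" for z
      using deriv_cong_open[OF U(1) that swap[OF that]] by (simp add: L_def)
    have "((\<lambda>z. deriv_head L [z, z]) \<longlongrightarrow> deriv_head L [w, w]) (at w)"
    proof (rule multi_holomorphic_tendsto[OF multi_holomorphic_deriv_head[OF L U(1)]])
      show "\<forall>\<^sub>F p in at w. length [p, p] = Suc (Suc 0) \<and> set [p, p] \<subseteq> U"
        using eventually_at_in_open'[OF U(1) w] by eventually_elim simp
      show "((\<lambda>p. [p, p] ! i) \<longlongrightarrow> [w, w] ! i) (at w)" if "i < Suc (Suc 0)" for i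
        using that by (cases i) auto
    qed (use w in auto)
    moreover have "\<forall>\<^sub>F z in at w. deriv_head L [z, z] = deriv (?H z) z"
      using eventually_at_in_open'[OF U(1) w] by eventually_elim (use eq in simp)
    ultimately show ?thesis
      unfolding eq[OF w] by (rule Lim_transform_eventually)
  qed
qed

text \<open>In the stable products each derivative meets only the factor containing its variable.
  \<open>X\<close> stands for the genus-lowering term, which does not factor.\<close>

lemma deriv_deriv_sum_product:
  fixes X :: "complex \<Rightarrow> complex \<Rightarrow> complex"
  assumes U: "open U" "z \<in> U"
    and X: "\<And>u. u \<in> U \<Longrightarrow> X u holomorphic_on U" "(\<lambda>u. deriv (X u) z) holomorphic_on U"
    and P: "\<And>a. a \<in> A \<Longrightarrow> P a holomorphic_on U" "\<And>a. a \<in> A \<Longrightarrow> Q a holomorphic_on U"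
  shows "deriv (\<lambda>u1. deriv (\<lambda>u2. X u1 u2 + (\<Sum>a\<in>A. P a u1 * Q a u2)) z) z =
    deriv (\<lambda>u1. deriv (X u1) z) z + (\<Sum>a\<in>A. deriv (P a) z * deriv (Q a) z)"
proof -
  have "deriv (\<lambda>u2. X u1 u2 + (\<Sum>a\<in>A. P a u1 * Q a u2)) z =
     deriv (X u1) z + (\<Sum>a\<in>A. P a u1 * deriv (Q a) z)" if "u1 \<in> U" for u1
    using that by (intro DERIV_imp_deriv DERIV_add DERIV_sum DERIV_cmult holomorphic_derivI[OF _ U] X P)
  then have "deriv (\<lambda>u1. deriv (\<lambda>u2. X u1 u2 + (\<Sum>a\<in>A. P a u1 * Q a u2)) z) z =
     deriv (\<lambda>u1. deriv (X u1) z + (\<Sum>a\<in>A. P a u1 * deriv (Q a) z)) z"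
    by (intro deriv_cong_open[OF U])
  also have "\<dots> = deriv (\<lambda>u1. deriv (X u1) z) z + (\<Sum>a\<in>A. deriv (P a) z * deriv (Q a) z)"
    by (intro DERIV_imp_deriv DERIV_add DERIV_sum DERIV_cmult_right holomorphic_derivI[OF _ U] X P)
  finally show ?thesis .
qed

text \<open>The hypothesis on \<open>om\<close> expresses that it has a simple pole of residue 1 at
  \<open>w\<close>: multiplied by an increment of \<open>h\<close>, it tends to the derivative of
  \<open>h\<close>.\<close>

lemma pde_recursion_diagonal:
  fixes U sg Om om F
  assumes U: "open U" and sg: "\<And>w. w \<in> U \<Longrightarrow> sg w \<noteq> w"
    and Om: "Om holomorphic_on U" "\<And>w. w \<in> U \<Longrightarrow> Om w \<noteq> 0"
    and om: "\<And>w h h'. w \<in> U \<Longrightarrow> (h has_field_derivative h') (at w) \<Longrightarrow>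
        ((\<lambda>z. om w (sg w) z * (h z - h w)) \<longlongrightarrow> h') (at w)"
    and F: "\<And>g n. n \<ge> 1 \<Longrightarrow> 2 * int g - 2 + int n \<ge> 1 \<Longrightarrow>
         multi_holomorphic U n (F g) \<and> multi_symmetric U n (F g)"
    and rec: "pde_recursion U sg Om om F"
    and w: "w \<in> U" and gm: "2 * int g - 2 + int (Suc m) \<ge> 2"
  defines "A \<equiv> {(g1, I). g1 \<le> g \<and> I \<subseteq> {..<m} \<and> 2 * int g1 - 1 + int (card I) > 0 \<and>
                    2 * int (g - g1) - 1 + int (card ({..<m} - I)) > 0}"
  shows "deriv_head (F g) (replicate (Suc m) w) =
     of_nat m * deriv (\<lambda>u. deriv_head (F g) (u # replicate (m - 1) w) / Om u) w +
     1 / Om w * ((if g = 0 then 0 else deriv (\<lambda>u1. deriv (\<lambda>u2. F (g - 1) (u1 # u2 # replicate m w)) w) w) +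
       (\<Sum>(g1, I)\<in>A. deriv_head (F g1) (replicate (Suc (card I)) w) *
                   deriv_head (F (g - g1)) (replicate (Suc (card ({..<m} - I))) w)))"
proof -
  define zs where "zs = replicate m w"
  have zs: "set zs \<subseteq> U" "length zs = m" using w by (auto simp: zs_def)
  have hol: "(\<lambda>u. F g' (u # xs)) holomorphic_on U"
    if "2 * int g' - 2 + int (Suc (length xs)) \<ge> 1" "set xs \<subseteq> U" for g' xs
    using F[of "Suc (length xs)" g'] that by (intro multi_holomorphic_Cons) auto
  \<comment> \<open>Both parts of each summand are \<open>om\<close> times a value of this one
    quotient, at \<open>z\<close> and at \<open>w\<close>.\<close>
  define h where "h = (\<lambda>u. deriv (\<lambda>t. F g (t # replicate (m - 1) w)) u / Om u)"
  define X where "X = (\<lambda>u1 u2. if g = 0 then 0 else F (g - 1) (u1 # u2 # zs))"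
  define P where "P = (\<lambda>(g1, I) u. F g1 (u # nths zs I))"
  define Q where "Q = (\<lambda>(g1, I) u. F (g - g1) (u # nths zs ({..<m} - I)))"
  have PQ: "P a holomorphic_on U" "Q a holomorphic_on U" if "a \<in> A" for a
  proof -
    obtain g1 I where a: "a = (g1, I)" by fastforce
    have "nths zs I = replicate (card I) w" "nths zs ({..<m} - I) = replicate (card ({..<m} - I)) w"
      using that unfolding a A_def zs_def by (auto intro!: nths_replicate_subset)
    then show "P a holomorphic_on U" "Q a holomorphic_on U"
      using that w unfolding a P_def Q_def A_def by (auto intro!: hol)
  qed
  have X: "X u holomorphic_on U" if "u \<in> U" for u
  proof (cases "g = 0")
    case False
    have "multi_holomorphic U (Suc (Suc m)) (F (g - 1))"
      using F[of "Suc (Suc m)" "g - 1"] gm False by (auto simp: of_nat_diff)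
    from multi_holomorphic_append[OF this, of "[u]" zs] that zs False show ?thesis
      unfolding X_def by simp
  qed (simp add: X_def)
  have X': "(\<lambda>u. deriv (X u) z) holomorphic_on U" if "z \<in> U" for z
  proof (cases "g = 0")
    case False
    then show ?thesis
      using F[of "Suc (Suc m)" "g - 1"] gm that zs U unfolding X_def
      by (simp add: of_nat_diff mixed_deriv_symmetric(1))
  qed (simp add: X_def)
  have X'': "((\<lambda>z. deriv (\<lambda>u. deriv (X u) z) z) \<longlongrightarrow> deriv (\<lambda>u. deriv (X u) w) w) (at w)"
  proof (cases "g = 0")
    case False
    then show ?thesis
      using F[of "Suc (Suc m)" "g - 1"] gm zs mixed_deriv_symmetric(2)[of U zs "F (g - 1)" w, OF _ _ U _ w]
      unfolding X_def by (simp add: of_nat_diff)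
  qed (simp add: X_def)
  have cont: "(deriv f \<longlongrightarrow> deriv f w) (at w)" if "f holomorphic_on U" for f
    using holomorphic_on_imp_continuous_on[OF holomorphic_deriv[OF that U]] U w
    by (simp add: continuous_on_eq_continuous_at isCont_def)
  have Om_lim: "(Om \<longlongrightarrow> Om w) (at w)"
    using holomorphic_on_imp_continuous_on[OF Om(1)] U w
    by (simp add: continuous_on_eq_continuous_at isCont_def)
  have sum_lim: "((\<lambda>z. \<Sum>j<m. om w (sg w) z * (h z - h w)) \<longlongrightarrow> (\<Sum>j<m. deriv h w)) (at w)"
  proof (intro tendsto_sum)
    fix j assume "j \<in> {..<m}"
    then have "h holomorphic_on U"
      unfolding h_def using gm w Om
      by (intro holomorphic_on_divide holomorphic_deriv[OF _ U] hol) (auto simp: of_nat_diff)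
    then show "((\<lambda>z. om w (sg w) z * (h z - h w)) \<longlongrightarrow> deriv h w) (at w)"
      by (intro om w holomorphic_derivI[OF _ U])
  qed
  define R where "R = (\<lambda>z. (\<Sum>j<m. om w (sg w) z * (h z - h w)) +
      1 / Om z * (deriv (\<lambda>u. deriv (X u) z) z + (\<Sum>a\<in>A. deriv (P a) z * deriv (Q a) z)))"
  \<comment> \<open>The recursion is silent at \<open>w\<close> and \<open>sg w\<close>; a punctured
    neighbourhood of \<open>w\<close> avoids both, because \<open>sg w\<close> differs from
    \<open>w\<close>.\<close>
  have "eventually (\<lambda>z. z \<in> U \<and> z \<noteq> w) (at w)"
    using eventually_at_in_open[OF U w] by eventually_elim auto
  moreover have "eventually (\<lambda>z. z \<noteq> sg w) (at w)"
    using eventually_neq_at_within .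
  ultimately have "eventually (\<lambda>z. deriv (\<lambda>u. F g (u # zs)) z = R z) (at w)"
  proof eventually_elim
    case (elim z)
    have "deriv (\<lambda>u. F g (u # zs)) z =
          (\<Sum>j<length zs.
             om (zs ! j) (sg (zs ! j)) z / Om z *
               deriv (\<lambda>u. F g (u # take j zs @ drop (Suc j) zs)) z
             - om (zs ! j) (sg (zs ! j)) z / Om (zs ! j) *
               deriv (\<lambda>u. F g (zs[j := u])) (zs ! j))
          + 1 / Om z *
            deriv (\<lambda>u1. deriv (\<lambda>u2.
              (if g = 0 then 0 else F (g - 1) (u1 # u2 # zs)) +
              (\<Sum>(g1, I) \<in> {(g1, I). g1 \<le> g \<and> I \<subseteq> {..<length zs} \<and>
                    2 * int g1 - 1 + int (card I) > 0 \<and>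
                    2 * int (g - g1) - 1 + int (card ({..<length zs} - I)) > 0}.
                 F g1 (u1 # nths zs I) * F (g - g1) (u2 # nths zs ({..<length zs} - I)))) z) z"
      by (rule rec[unfolded pde_recursion_def, rule_format])
        (use elim gm zs in \<open>auto simp: zs_def\<close>)
    also have "(\<Sum>j<length zs.
             om (zs ! j) (sg (zs ! j)) z / Om z *
               deriv (\<lambda>u. F g (u # take j zs @ drop (Suc j) zs)) z
             - om (zs ! j) (sg (zs ! j)) z / Om (zs ! j) *
               deriv (\<lambda>u. F g (zs[j := u])) (zs ! j)) =
         (\<Sum>j<m. om w (sg w) z * (h z - h w))"
    proof (rule sum.cong)
      fix j assume "j \<in> {..<m}"
      then have j: "j < m" by simp
      have nth: "zs ! j = w" using j by (simp add: zs_def)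
      have td: "take j zs @ drop (Suc j) zs = replicate (m - 1) w"
        using j by (simp add: zs_def min_def flip: replicate_add)
      \<comment> \<open>By symmetry the derivative in slot \<open>j\<close> is the head derivative
        of the function with one variable fewer, that is, the numerator of \<open>h\<close> at
        \<open>w\<close>.\<close>
      have "deriv (\<lambda>u. F g (zs[j := u])) w = deriv (\<lambda>u. F g (u # replicate (m - 1) w)) w"
      proof (rule deriv_cong_open[OF U w])
        fix u assume u: "u \<in> U"
        have "zs[j := u] = take j zs @ u # drop (Suc j) zs"
          using j zs by (simp add: upd_conv_take_nth_drop)
        then have "mset (zs[j := u]) = mset (u # replicate (m - 1) w)"
          unfolding td[symmetric] by simp
        then show "F g (zs[j := u]) = F g (u # replicate (m - 1) w)"
          using F[of m g] gm j u w by (intro multi_symmetricD[of U m]) auto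
      qed
      then show "om (zs ! j) (sg (zs ! j)) z / Om z *
               deriv (\<lambda>u. F g (u # take j zs @ drop (Suc j) zs)) z
             - om (zs ! j) (sg (zs ! j)) z / Om (zs ! j) *
               deriv (\<lambda>u. F g (zs[j := u])) (zs ! j) = om w (sg w) z * (h z - h w)"
        unfolding nth td h_def by (simp add: right_diff_distrib)
    qed (simp add: zs)
    also have "(\<lambda>u1. deriv (\<lambda>u2.
              (if g = 0 then 0 else F (g - 1) (u1 # u2 # zs)) +
              (\<Sum>(g1, I) \<in> {(g1, I). g1 \<le> g \<and> I \<subseteq> {..<length zs} \<and>
                    2 * int g1 - 1 + int (card I) > 0 \<and>
                    2 * int (g - g1) - 1 + int (card ({..<length zs} - I)) > 0}.
                 F g1 (u1 # nths zs I) * F (g - g1) (u2 # nths zs ({..<length zs} - I)))) z) =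
         (\<lambda>u1. deriv (\<lambda>u2. X u1 u2 + (\<Sum>a\<in>A. P a u1 * Q a u2)) z)"
      unfolding X_def P_def Q_def A_def zs(2) by (simp add: case_prod_unfold)
    also have "deriv (\<lambda>u1. deriv (\<lambda>u2. X u1 u2 + (\<Sum>a\<in>A. P a u1 * Q a u2)) z) z =
        deriv (\<lambda>u. deriv (X u) z) z + (\<Sum>a\<in>A. deriv (P a) z * deriv (Q a) z)"
      using elim by (intro deriv_deriv_sum_product[OF U] X X' PQ) auto
    finally show ?case by (simp add: R_def)
  qed
  moreover have "(R \<longlongrightarrow> (\<Sum>j<m. deriv h w) +
      1 / Om w * (deriv (\<lambda>u. deriv (X u) w) w + (\<Sum>a\<in>A. deriv (P a) w * deriv (Q a) w))) (at w)"
    unfolding R_def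
    by (intro tendsto_add sum_lim tendsto_mult tendsto_divide tendsto_const Om_lim X'' tendsto_sum cont PQ Om w)
  ultimately have "((\<lambda>z. deriv (\<lambda>u. F g (u # zs)) z) \<longlongrightarrow> (\<Sum>j<m. deriv h w) +
      1 / Om w * (deriv (\<lambda>u. deriv (X u) w) w + (\<Sum>a\<in>A. deriv (P a) w * deriv (Q a) w))) (at w)"
    by (simp add: tendsto_cong)
  moreover have "((\<lambda>z. deriv (\<lambda>u. F g (u # zs)) z) \<longlongrightarrow> deriv (\<lambda>u. F g (u # zs)) w) (at w)"
    using gm zs by (intro cont hol) auto
  \<comment> \<open>The left side of the recursion is continuous at \<open>w\<close>, so its value
    there equals the limit of the right side.\<close>
  ultimately have "deriv (\<lambda>u. F g (u # zs)) w = (\<Sum>j<m. deriv h w) +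
      1 / Om w * (deriv (\<lambda>u. deriv (X u) w) w + (\<Sum>a\<in>A. deriv (P a) w * deriv (Q a) w))"
    by (intro tendsto_unique[OF trivial_limit_at]) 
  also have "(\<Sum>a\<in>A. deriv (P a) w * deriv (Q a) w) =
     (\<Sum>(g1, I)\<in>A. deriv_head (F g1) (replicate (Suc (card I)) w) *
                   deriv_head (F (g - g1)) (replicate (Suc (card ({..<m} - I))) w))"
    by (intro sum.cong refl) (auto simp: P_def Q_def A_def zs_def nths_replicate_subset)
  also have "deriv (\<lambda>u. deriv (X u) w) w =
     (if g = 0 then 0 else deriv (\<lambda>u1. deriv (\<lambda>u2. F (g - 1) (u1 # u2 # replicate m w)) w) w)"
    by (simp add: X_def zs_def)
  finally show ?thesis by (simp add: h_def zs_def)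
qed

section \<open>Sums over pairs graded by \<open>2 * g + m\<close>\<close>

lemma finite_weighted_pairs [simp]: "finite {(g, m). 2 * g + m = (k::nat)}"
  by (rule finite_subset[of _ "{..k} \<times> {..k}"]) auto

lemma of_nat_Suc_div_fact: "of_nat (Suc m) * x / fact (Suc m) = (x / fact m :: complex)"
  by (simp add: fact_Suc del: of_nat_Suc)

text \<open>For the residue terms: the factor \<open>m\<close> kills \<open>m = 0\<close> and lowers
  the factorial, so removing one variable lowers the degree by one.\<close>

lemma sum_weighted_pairs_Suc:
  fixes f :: "nat \<Rightarrow> nat \<Rightarrow> complex"
  shows "(\<Sum>(g, m)\<in>{(g, m). 2 * g + m = Suc k}. of_nat m / fact m * f g (m - 1)) =
    (\<Sum>(g, m)\<in>{(g, m). 2 * g + m = k}. f g m / fact m)" (is "?l = ?r")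
proof -
  have "?l = (\<Sum>(g, m)\<in>{(g, m). 2 * g + m = Suc k \<and> m > 0}. of_nat m / fact m * f g (m - 1))"
    by (intro sum.mono_neutral_right) auto
  also have "\<dots> = ?r"
    by (rule sum.reindex_bij_witness[where i = "\<lambda>(g, m). (g, Suc m)" and j = "\<lambda>(g, m). (g, m - 1)"])
      (auto simp: fact_reduce field_simps)
  finally show ?thesis .
qed

text \<open>For the genus-lowering terms: trading one handle for one variable lowers the degree by 2
  - 1, and \<open>1/m!\<close> equals \<open>(m + 1)/(m + 1)!\<close>.\<close>

lemma sum_weighted_pairs_shift:
  fixes f :: "nat \<Rightarrow> nat \<Rightarrow> complex"
  shows "(\<Sum>(g, m)\<in>{(g, m). 2 * g + m = Suc k}. 1 / fact m * (if g = 0 then 0 else f (g - 1) (Suc m))) =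
    (\<Sum>(g, m)\<in>{(g, m). 2 * g + m = k}. of_nat m / fact m * f g m)" (is "?l = ?r")
proof -
  have "?l = (\<Sum>(g, m)\<in>{(g, m). 2 * g + m = Suc k \<and> g > 0}. 1 / fact m * (if g = 0 then 0 else f (g - 1) (Suc m)))"
    by (intro sum.mono_neutral_right) (auto split: if_splits)
  also have "\<dots> = (\<Sum>(g, m)\<in>{(g, m). 2 * g + m = k \<and> m > 0}. of_nat m / fact m * f g m)"
    by (rule sum.reindex_bij_witness[where j = "\<lambda>(g, m). (g - 1, Suc m)" and i = "\<lambda>(g, m). (Suc g, m - 1)"])
      (auto simp: of_nat_Suc_div_fact simp del: of_nat_Suc fact_Suc)
  also have "\<dots> = ?r"
    by (intro sum.mono_neutral_left) auto
  finally show ?thesis .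
qed

lemma sum_Pow_card:
  fixes f :: "nat \<Rightarrow> complex"
  shows "(\<Sum>I\<in>Pow {..<m}. f (card I)) = (\<Sum>k\<le>m. of_nat (m choose k) * f k)"
proof -
  have "(\<Sum>I\<in>Pow {..<m}. f (card I)) = (\<Sum>k\<in>{..m}. \<Sum>I\<in>{I\<in>Pow {..<m}. card I = k}. f (card I))"
    by (rule sum.group[symmetric]) (auto dest: card_mono[rotated])
  also have "\<dots> = (\<Sum>k\<le>m. of_nat (card {I. I \<subseteq> {..<m} \<and> card I = k}) * f k)"
    by (intro sum.cong refl) (simp add: Pow_def)
  finally show ?thesis by (simp add: n_subsets)
qed

text \<open>A splitting depends on the cardinality of one block, and the binomial coefficient over
  \<open>m!\<close> gives the product of inverse factorials. Setting \<open>t\<close> to zero at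
  unstable indices absorbs both stability conditions, so the convolution needs no side
  condition.\<close>

lemma sum_splittings:
  fixes a :: "nat \<Rightarrow> nat \<Rightarrow> complex"
  defines "t \<equiv> \<lambda>g k. if 2 * g + k < 2 then 0 else a g k / fact k"
  shows "1 / fact m * (\<Sum>(g1, I)\<in>{(g1, I). g1 \<le> g \<and> I \<subseteq> {..<m} \<and> 2 * int g1 - 1 + int (card I) > 0 \<and>
                    2 * int (g - g1) - 1 + int (card ({..<m} - I)) > 0}.
            a g1 (card I) * a (g - g1) (card ({..<m} - I))) =
         (\<Sum>g1\<le>g. \<Sum>k\<le>m. t g1 k * t (g - g1) (m - k))"
proof -
  let ?c = "\<lambda>g1 k. 2 * g1 + k \<ge> 2 \<and> 2 * (g - g1) + (m - k) \<ge> 2"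
  let ?f = "\<lambda>g1 k. if ?c g1 k then a g1 k * a (g - g1) (m - k) else 0"
  have card: "card ({..<m} - I) = m - card I" "card I \<le> m" if "I \<subseteq> {..<m}" for I
    using that by (auto simp: card_Diff_subset finite_subset dest: card_mono[rotated])
  let ?A = "{(g1, I). g1 \<le> g \<and> I \<subseteq> {..<m} \<and> 2 * int g1 - 1 + int (card I) > 0 \<and>
                    2 * int (g - g1) - 1 + int (card ({..<m} - I)) > 0}"
  have "(\<Sum>(g1, I)\<in>?A. a g1 (card I) * a (g - g1) (card ({..<m} - I))) =
        (\<Sum>(g1, I)\<in>{..g} \<times> Pow {..<m}. ?f g1 (card I))"
  proof (rule sum.mono_neutral_cong_left, goal_cases)
    case 3
    show ?case
    proof
      fix p assume "p \<in> {..g} \<times> Pow {..<m} - ?A"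
      then obtain g1 I where p: "p = (g1, I)" "g1 \<le> g" "I \<subseteq> {..<m}"
        "\<not> (2 * int g1 - 1 + int (card I) > 0 \<and> 2 * int (g - g1) - 1 + int (card ({..<m} - I)) > 0)"
        by blast
      have "\<not> ?c g1 (card I)" using p(4) unfolding card(1)[OF p(3)] by linarith
      then show "(case p of (g1, I) \<Rightarrow> ?f g1 (card I)) = 0" unfolding p(1) prod.case by (rule if_not_P)
    qed
  next
    case (4 p)
    then obtain g1 I where p: "p = (g1, I)" "I \<subseteq> {..<m}"
        "2 * int g1 - 1 + int (card I) > 0" "2 * int (g - g1) - 1 + int (card ({..<m} - I)) > 0"
      by blast
    have c: "?c g1 (card I)" using p(3,4) unfolding card(1)[OF p(2)] by linarith
    show ?case unfolding p(1) prod.case if_P[OF c] card(1)[OF p(2)] ..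
  qed auto
  also have "\<dots> = (\<Sum>g1\<le>g. \<Sum>I\<in>Pow {..<m}. ?f g1 (card I))"
    by (rule sum.cartesian_product[symmetric])
  also have "\<dots> = (\<Sum>g1\<le>g. \<Sum>k\<le>m. of_nat (m choose k) * ?f g1 k)"
    by (intro sum.cong refl sum_Pow_card)
  finally have sum: "(\<Sum>(g1, I)\<in>?A. a g1 (card I) * a (g - g1) (card ({..<m} - I))) = \<dots>" .
  show ?thesis unfolding sum sum_distrib_left
  proof (intro sum.cong refl)
    fix g1 k assume "k \<in> {..m}"
    then have k: "k \<le> m" by simp
    show "1 / fact m * (of_nat (m choose k) * ?f g1 k) = t g1 k * t (g - g1) (m - k)"
    proof (cases "?c g1 k")
      case True
      then have "t g1 k = a g1 k / fact k" "t (g - g1) (m - k) = a (g - g1) (m - k) / fact (m - k)"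
        by (auto simp: t_def)
      then show ?thesis unfolding if_P[OF True] binomial_fact[OF k] by simp
    next
      case False
      then have "t g1 k * t (g - g1) (m - k) = 0" by (auto simp: t_def)
      then show ?thesis unfolding if_not_P[OF False] by simp
    qed
  qed
qed

text \<open>The degree is additive under splitting, so this is a Cauchy product: the reindexing
  records the degree \<open>j\<close> of the first factor and the complementary pair.\<close>

lemma sum_weighted_pairs_convolution:
  fixes t :: "nat \<Rightarrow> nat \<Rightarrow> complex"
  shows "(\<Sum>(g, m)\<in>{(g, m). 2 * g + m = K}. \<Sum>g1\<le>g. \<Sum>k\<le>m. t g1 k * t (g - g1) (m - k)) =
    (\<Sum>j\<le>K. (\<Sum>(g, m)\<in>{(g, m). 2 * g + m = j}. t g m) * (\<Sum>(g, m)\<in>{(g, m). 2 * g + m = K - j}. t g m))"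
proof -
  let ?Q = "\<lambda>k. {(g, m). 2 * g + m = (k::nat)}"
  have "(\<Sum>(g, m)\<in>?Q K. \<Sum>g1\<le>g. \<Sum>k\<le>m. t g1 k * t (g - g1) (m - k)) =
    (\<Sum>p\<in>?Q K. \<Sum>(g1, k)\<in>{..fst p} \<times> {..snd p}. t g1 k * t (fst p - g1) (snd p - k))"
    by (simp add: sum.cartesian_product case_prod_unfold)
  also have "\<dots> = (\<Sum>((g, m), (g1, k))\<in>Sigma (?Q K) (\<lambda>p. {..fst p} \<times> {..snd p}). t g1 k * t (g - g1) (m - k))"
    by (subst sum.Sigma) (simp_all add: case_prod_beta)
  also have "\<dots> = (\<Sum>(j, ((g1, k), (g2, l)))\<in>Sigma {..K} (\<lambda>j. ?Q j \<times> ?Q (K - j)). t g1 k * t g2 l)"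
    by (rule sum.reindex_bij_witness[where j = "\<lambda>((g, m), (g1, k)). (2 * g1 + k, ((g1, k), (g - g1, m - k)))"
        and i = "\<lambda>(j, ((g1, k), (g2, l))). ((g1 + g2, k + l), (g1, k))"]) auto
  also have "\<dots> = (\<Sum>j\<le>K. \<Sum>((g1, k), (g2, l))\<in>?Q j \<times> ?Q (K - j). t g1 k * t g2 l)"
    by (subst sum.Sigma) (simp_all add: case_prod_beta)
  also have "\<dots> = (\<Sum>j\<le>K. (\<Sum>(g, m)\<in>?Q j. t g m) * (\<Sum>(g, m)\<in>?Q (K - j). t g m))"
    by (simp add: sum_product sum.cartesian_product case_prod_unfold)
  finally show ?thesis .
qed

lemma sum_over_stable_range:
  "(\<Sum>(g, n) \<in> {(g, n). n \<ge> 1 \<and> 2 * int g - 2 + int n = int m - 1}. f g n) =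
   (\<Sum>(g, k) \<in> {(g, k). 2 * g + k = m}. f g (Suc k) :: complex)"
  by (rule sum.reindex_bij_witness[where j = "\<lambda>(g, n). (g, n - 1)" and i = "\<lambda>(g, k). (g, Suc k)"]) auto

text \<open>This is \<open>S m\<close> as a function on the covering, with \<open>k = n - 1\<close>.
  It is meaningful for \<open>m >= 2\<close>; smaller \<open>m\<close> would involve the unstable
  functions of genus 0.\<close>

definition diag_sum :: "(nat \<Rightarrow> complex list \<Rightarrow> complex) \<Rightarrow> nat \<Rightarrow> complex \<Rightarrow> complex" where
  "diag_sum F m z = (\<Sum>(g, k) \<in> {(g, k). 2 * g + k = m}. 1 / fact (Suc k) * F g (replicate (Suc k) z))"

text \<open>One differentiation reduces \<open>1/(k + 1)!\<close> to \<open>1/k!\<close>; the next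
  yields pure second derivatives with weight \<open>1/k!\<close> and mixed ones with weight
  \<open>k/k!\<close>, the very weights left by the two degree shifts of the recursion.\<close>

lemma
  assumes U: "open U"
    and F: "\<And>g n. n \<ge> 1 \<Longrightarrow> 2 * int g - 2 + int n \<ge> 1 \<Longrightarrow>
         multi_holomorphic U n (F g) \<and> multi_symmetric U n (F g)"
    and m: "m \<ge> 2"
  shows deriv_diag_sum: "z \<in> U \<Longrightarrow> (diag_sum F m has_field_derivative
           (\<Sum>(g, k) \<in> {(g, k). 2 * g + k = m}. deriv_head (F g) (replicate (Suc k) z) / fact k)) (at z)"
    and deriv_deriv_diag_sum: "z \<in> U \<Longrightarrow> deriv (deriv (diag_sum F m)) z =
           (\<Sum>(g, k) \<in> {(g, k). 2 * g + k = m}. deriv (\<lambda>u. deriv_head (F g) (u # replicate k z)) z / fact k) +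
           (\<Sum>(g, k) \<in> {(g, k). 2 * g + k = m}. of_nat k / fact k *
              deriv (\<lambda>u1. deriv (\<lambda>u2. F g (u1 # u2 # replicate (k - 1) z)) z) z)"
proof -
  have F': "multi_holomorphic U (Suc k) (F g)" "multi_symmetric U (Suc k) (F g)" if "2 * g + k = m" for g k
    using F[of "Suc k" g] that m by auto
  show D: "(diag_sum F m has_field_derivative
      (\<Sum>(g, k) \<in> {(g, k). 2 * g + k = m}. deriv_head (F g) (replicate (Suc k) z) / fact k)) (at z)"
    if z: "z \<in> U" for z
    unfolding diag_sum_def case_prod_unfold
  proof (rule DERIV_sum, goal_cases)
    case (1 p)
    then obtain g k where p: "p = (g, k)" "2 * g + k = m" by (cases p) auto
    have "((\<lambda>z. 1 / fact (Suc k) * F g (replicate (Suc k) z)) has_field_derivative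
      1 / fact (Suc k) * (of_nat (Suc k) * deriv_head (F g) (replicate (Suc k) z))) (at z)"
      by (rule DERIV_cmult[OF has_field_derivative_replicate_symmetric[OF F'[OF p(2)] U z]])
    also have "1 / fact (Suc k) * (of_nat (Suc k) * deriv_head (F g) (replicate (Suc k) z)) =
        deriv_head (F g) (replicate (Suc k) z) / fact k"
      by (simp only: fact_Suc) (simp add: field_simps del: of_nat_Suc)
    finally show ?case by (simp add: p)
  qed
  show "deriv (deriv (diag_sum F m)) z =
           (\<Sum>(g, k) \<in> {(g, k). 2 * g + k = m}. deriv (\<lambda>u. deriv_head (F g) (u # replicate k z)) z / fact k) +
           (\<Sum>(g, k) \<in> {(g, k). 2 * g + k = m}. of_nat k / fact k *
              deriv (\<lambda>u1. deriv (\<lambda>u2. F g (u1 # u2 # replicate (k - 1) z)) z) z)"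
    if z: "z \<in> U"
  proof -
    have "deriv (deriv (diag_sum F m)) z =
       deriv (\<lambda>z. \<Sum>(g, k) \<in> {(g, k). 2 * g + k = m}. deriv_head (F g) (replicate (Suc k) z) / fact k) z"
      by (intro deriv_cong_open[OF U z] DERIV_imp_deriv D)
    also have "\<dots> = (\<Sum>(g, k) \<in> {(g, k). 2 * g + k = m}.
        (deriv (\<lambda>u. deriv_head (F g) (u # replicate k z)) z +
           of_nat k * deriv (\<lambda>u1. deriv (\<lambda>u2. F g (u1 # u2 # replicate (k - 1) z)) z) z) / fact k)"
      unfolding case_prod_unfold
    proof (intro DERIV_imp_deriv DERIV_sum, goal_cases)
      case (1 p)
      then obtain g k where p: "p = (g, k)" "2 * g + k = m" by (cases p) auto
      show ?case unfolding p fst_conv snd_conv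
        by (rule DERIV_cdivide[OF has_field_derivative_deriv_head_replicate[OF F'[OF p(2)] U z]])
    qed
    also have "\<dots> = (\<Sum>(g, k) \<in> {(g, k). 2 * g + k = m}. deriv (\<lambda>u. deriv_head (F g) (u # replicate k z)) z / fact k) +
           (\<Sum>(g, k) \<in> {(g, k). 2 * g + k = m}. of_nat k / fact k *
              deriv (\<lambda>u1. deriv (\<lambda>u2. F g (u1 # u2 # replicate (k - 1) z)) z) z)"
      by (simp add: case_prod_unfold add_divide_distrib sum.distrib)
    finally show ?thesis .
  qed
qed

text \<open>Residue and genus-lowering terms drop the degree from \<open>Suc M\<close> to
  \<open>M\<close> and supply the pure and mixed halves of the second derivative; the products keep
  total degree \<open>Suc M\<close>. The cut-off in \<open>T\<close> reflects that unstable factors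
  are excluded.\<close>

lemma diag_sum_recursion:
  fixes U sg Om om F
  assumes U: "open U" and sg: "\<And>w. w \<in> U \<Longrightarrow> sg w \<noteq> w"
    and Om: "Om holomorphic_on U" "\<And>w. w \<in> U \<Longrightarrow> Om w \<noteq> 0"
    and om: "\<And>w h h'. w \<in> U \<Longrightarrow> (h has_field_derivative h') (at w) \<Longrightarrow>
        ((\<lambda>z. om w (sg w) z * (h z - h w)) \<longlongrightarrow> h') (at w)"
    and F: "\<And>g n. n \<ge> 1 \<Longrightarrow> 2 * int g - 2 + int n \<ge> 1 \<Longrightarrow>
         multi_holomorphic U n (F g) \<and> multi_symmetric U n (F g)"
    and rec: "pde_recursion U sg Om om F"
    and w: "w \<in> U" and M: "M \<ge> 2"
  defines "T \<equiv> \<lambda>j. if j < 2 then 0 else deriv (diag_sum F j) w"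
  shows "Om w * deriv (diag_sum F (Suc M)) w =
     deriv (deriv (diag_sum F M)) w - deriv Om w / Om w * deriv (diag_sum F M) w +
     (\<Sum>j\<le>Suc M. T j * T (Suc M - j))"
proof -
  define a where "a = (\<lambda>g k. deriv_head (F g) (replicate (Suc k) w))"
  define b where "b = (\<lambda>g k. deriv (\<lambda>u. deriv_head (F g) (u # replicate k w)) w)"
  define c where "c = (\<lambda>g k. deriv (\<lambda>u1. deriv (\<lambda>u2. F g (u1 # u2 # replicate (k - 1) w)) w) w)"
  \<comment> \<open>This is \<open>Om w\<close> times the derivative of the quotient by
    \<open>Om\<close>; its second term comes from differentiating the denominator.\<close>
  define d where "d = (\<lambda>g k. b g k - deriv Om w / Om w * a g k)"
  define t where "t = (\<lambda>g k. if 2 * g + k < 2 then 0 else a g k / fact k)"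
  let ?Q = "\<lambda>k. {(g, m). 2 * g + m = (k::nat)}"
  let ?A = "\<lambda>g m. {(g1, I). g1 \<le> g \<and> I \<subseteq> {..<m} \<and> 2 * int g1 - 1 + int (card I) > 0 \<and>
                    2 * int (g - g1) - 1 + int (card ({..<m} - I)) > 0}"
  let ?s = "\<lambda>g m. \<Sum>(g1, I)\<in>?A g m. a g1 (card I) * a (g - g1) (card ({..<m} - I))"
  have step: "Om w * a g m = of_nat m * d g (m - 1) + ((if g = 0 then 0 else c (g - 1) (Suc m)) + ?s g m)"
    if gm: "2 * g + m = Suc M" for g m
  proof -
    have "a g m = of_nat m * deriv (\<lambda>u. deriv_head (F g) (u # replicate (m - 1) w) / Om u) w +
      1 / Om w * ((if g = 0 then 0 else c (g - 1) (Suc m)) + ?s g m)"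
      unfolding a_def c_def diff_Suc_1
      by (rule pde_recursion_diagonal[OF U _ Om(1) _ _ _ rec w])
        (erule sg Om(2) om F | assumption | use gm M in simp)+
    moreover have "of_nat m * deriv (\<lambda>u. deriv_head (F g) (u # replicate (m - 1) w) / Om u) w =
      of_nat m * (d g (m - 1) / Om w)"
    proof (cases m)
      case (Suc k)
      have "(\<lambda>u. deriv_head (F g) (u # replicate k w)) holomorphic_on U"
        unfolding deriv_head_Cons using gm M Suc F[of "Suc k" g] w
        by (intro holomorphic_deriv[OF _ U] multi_holomorphic_Cons[of U "Suc k"]) auto
      then have "deriv (\<lambda>u. deriv_head (F g) (u # replicate k w) / Om u) w =
          (b g k * Om w - a g k * deriv Om w) / (Om w)\<^sup>2"
        unfolding a_def b_def replicate_Suc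
        by (intro deriv_divide holomorphic_on_imp_differentiable_at[OF _ U w] Om w)
      also have "\<dots> = d g k / Om w"
        using Om(2)[OF w] by (simp add: d_def field_simps power2_eq_square)
      finally show ?thesis using Suc by simp
    qed simp
    ultimately show ?thesis using Om(2)[OF w] by (simp add: field_simps)
  qed
  have D: "deriv (diag_sum F j) w = (\<Sum>(g, k)\<in>?Q j. a g k / fact k)" if "j \<ge> 2" for j
    unfolding a_def by (rule DERIV_imp_deriv[OF deriv_diag_sum[OF U F that w]])
  have T: "T j = (\<Sum>(g, k)\<in>?Q j. t g k)" for j
  proof (cases "j < 2")
    case True
    then have "(\<Sum>(g, k)\<in>?Q j. t g k) = 0" by (intro sum.neutral) (auto simp: t_def)
    with True show ?thesis by (simp add: T_def)
  next
    case False
    then show ?thesis using D[of j] by (auto simp: T_def t_def intro!: sum.cong)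
  qed
  have "Om w * deriv (diag_sum F (Suc M)) w = (\<Sum>(g, m)\<in>?Q (Suc M). 1 / fact m * (Om w * a g m))"
    using M by (simp add: D sum_distrib_left case_prod_unfold)
  also have "\<dots> = (\<Sum>(g, m)\<in>?Q (Suc M). of_nat m / fact m * d g (m - 1) +
      1 / fact m * (if g = 0 then 0 else c (g - 1) (Suc m)) + 1 / fact m * ?s g m)"
  proof (rule sum.cong, goal_cases)
    case (2 p)
    then obtain g m where p: "p = (g, m)" "2 * g + m = Suc M" by auto
    show ?case unfolding p prod.case step[OF p(2)] by (simp only: distrib_left) simp
  qed simp
  also have "\<dots> = (\<Sum>(g, m)\<in>?Q (Suc M). of_nat m / fact m * d g (m - 1)) +
      (\<Sum>(g, m)\<in>?Q (Suc M). 1 / fact m * (if g = 0 then 0 else c (g - 1) (Suc m))) +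
      (\<Sum>(g, m)\<in>?Q (Suc M). 1 / fact m * ?s g m)"
    by (simp only: case_prod_unfold sum.distrib)
  also have "(\<Sum>(g, m)\<in>?Q (Suc M). of_nat m / fact m * d g (m - 1)) =
      (\<Sum>(g, m)\<in>?Q M. b g m / fact m) - deriv Om w / Om w * deriv (diag_sum F M) w"
    unfolding sum_weighted_pairs_Suc D[OF M]
    by (simp add: d_def case_prod_unfold sum_distrib_left sum_subtractf diff_divide_distrib)
  also have "(\<Sum>(g, m)\<in>?Q (Suc M). 1 / fact m * (if g = 0 then 0 else c (g - 1) (Suc m))) =
      (\<Sum>(g, m)\<in>?Q M. of_nat m / fact m * c g m)"
    by (rule sum_weighted_pairs_shift)
  also have "(\<Sum>(g, m)\<in>?Q (Suc M). 1 / fact m * ?s g m) = (\<Sum>j\<le>Suc M. T j * T (Suc M - j))"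
    unfolding sum_splittings T t_def by (rule sum_weighted_pairs_convolution)
  finally show ?thesis
    using deriv_deriv_diag_sum[OF U F M w] by (simp add: b_def c_def)
qed

section \<open>The spectral curve and the prime form\<close>

text \<open>At a simple zero the logarithmic derivative has residue 1 whatever the value of
  \<open>deriv f w\<close>, while that of \<open>k\<close> stays bounded and is killed by the
  increment of \<open>h\<close>.\<close>

lemma log_derivative_difference_tendsto:
  fixes f k h :: "complex \<Rightarrow> complex"
  assumes V: "open V" "w \<in> V" and f: "f holomorphic_on V" "f w = 0" "deriv f w \<noteq> 0"
    and k: "k holomorphic_on V" "k w \<noteq> 0" and h: "(h has_field_derivative h') (at w)"
  shows "((\<lambda>z. (deriv f z / f z - deriv k z / k z) * (h z - h w)) \<longlongrightarrow> h') (at w)"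
proof -
  have lim: "(g \<longlongrightarrow> g w) (at w)" if "g holomorphic_on V" for g
    using holomorphic_on_imp_continuous_on[OF that] V
    by (simp add: continuous_on_eq_continuous_at isCont_def)
  note df = lim[OF holomorphic_deriv[OF f(1) V(1)]] and dk = lim[OF holomorphic_deriv[OF k(1) V(1)]]
  have "((\<lambda>z. f z / (z - w)) \<longlongrightarrow> deriv f w) (at w)"
    using holomorphic_derivI[OF f(1) V] f(2) by (simp add: has_field_derivative_iff)
  then have 1: "((\<lambda>z. deriv f z / (f z / (z - w))) \<longlongrightarrow> deriv f w / deriv f w) (at w)"
    by (intro tendsto_divide df f)
  have 2: "((\<lambda>z. (h z - h w) / (z - w)) \<longlongrightarrow> h') (at w)"
    using h by (simp add: has_field_derivative_iff)
  have "(h \<longlongrightarrow> h w) (at w)"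
    using DERIV_isCont[OF h] by (simp add: isCont_def)
  then have "((\<lambda>z. deriv k z / k z * (h z - h w)) \<longlongrightarrow> deriv k w / k w * (h w - h w)) (at w)"
    by (intro tendsto_mult tendsto_divide tendsto_diff tendsto_const dk lim[OF k(1)] k(2))
  from tendsto_diff[OF tendsto_mult[OF 1 2] this]
  have "((\<lambda>z. deriv f z / (f z / (z - w)) * ((h z - h w) / (z - w)) - deriv k z / k z * (h z - h w)) \<longlongrightarrow> h') (at w)"
    using f(3) by simp
  then show ?thesis
    by (rule Lim_transform_eventually) (auto simp: eventually_at_filter left_diff_distrib)
qed

section \<open>Riemann surfaces in charts\<close>

lemma riemann_surface_chart:
  assumes "riemann_surface A"
  shows "open (nbhd A i)" "open (cimage A i)" "continuous_on (nbhd A i) (coord A i)"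
    "continuous_on (cimage A i) (chart_inv A i)"
    "s \<in> nbhd A i \<Longrightarrow> chart_inv A i (coord A i s) = s"
    "z \<in> cimage A i \<Longrightarrow> coord A i (chart_inv A i z) = z"
    "z \<in> cimage A i \<Longrightarrow> chart_inv A i z \<in> nbhd A i"
proof -
  have h: "homeomorphism (nbhd A i) (cimage A i) (coord A i) (chart_inv A i)"
    and o: "open (nbhd A i)" "open (cimage A i)"
    using assms unfolding riemann_surface_def by blast+
  show "open (nbhd A i)" "open (cimage A i)" by (fact o)+
  show "continuous_on (nbhd A i) (coord A i)" "continuous_on (cimage A i) (chart_inv A i)"
    using h unfolding homeomorphism_def by blast+
  show "s \<in> nbhd A i \<Longrightarrow> chart_inv A i (coord A i s) = s"
    "z \<in> cimage A i \<Longrightarrow> coord A i (chart_inv A i z) = z"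
    using h unfolding homeomorphism_def by blast+
  show "z \<in> cimage A i \<Longrightarrow> chart_inv A i z \<in> nbhd A i"
    using h unfolding homeomorphism_def by blast
qed

lemma chart_at_mem:
  assumes "riemann_surface A"
  shows "s \<in> nbhd A (chart_at A s)"
proof -
  have "\<exists>i. s \<in> nbhd A i" using assms unfolding riemann_surface_def by blast
  then show ?thesis unfolding chart_at_def by (rule someI_ex)
qed

lemma open_coord_image:
  assumes A: "riemann_surface A" and V: "open V"
  shows "open (coord A i ` (nbhd A i \<inter> V))"
proof -
  have "coord A i ` (nbhd A i \<inter> V) = cimage A i \<inter> chart_inv A i -` V"
    using riemann_surface_chart(5-7)[OF A] by force
  then show ?thesis
    using riemann_surface_chart(2,4)[OF A, of i] V by (simp add: continuous_open_preimage)
qed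

lemma holo_map_analytic:
  assumes A: "riemann_surface A" and B: "riemann_surface B" and f: "holo_map A B f"
    and s: "s \<in> nbhd A k" "f s \<in> nbhd B l"
  shows "(\<lambda>z. coord B l (f (chart_inv A k z))) analytic_on {coord A k s}"
proof -
  have "open (f -` nbhd B l)"
    using f riemann_surface_chart(1)[OF B] unfolding holo_map_def
    by (intro open_vimage) auto
  then have "open (coord A k ` (nbhd A k \<inter> f -` nbhd B l))" by (rule open_coord_image[OF A])
  moreover have "(\<lambda>z. coord B l (f (chart_inv A k z))) holomorphic_on (coord A k ` (nbhd A k \<inter> f -` nbhd B l))"
    using f unfolding holo_map_def by blast
  ultimately show ?thesis using s by (auto simp: analytic_at)
qed

text \<open>Lets transition functions be treated as the identity map written in two charts.\<close>

lemma holo_map_ident: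
  assumes "riemann_surface A"
  shows "holo_map A A (\<lambda>s. s)"
proof -
  have "(\<lambda>x. coord A j (chart_inv A i x)) holomorphic_on (coord A i ` (nbhd A i \<inter> nbhd A j))" for i j
    using assms unfolding riemann_surface_def by (metis inf_commute)
  then show ?thesis unfolding holo_map_def by (simp add: continuous_on_id)
qed

lemma deriv_comp_holo_map:
  fixes \<phi> :: "'b::t2_space \<Rightarrow> complex"
  assumes A: "riemann_surface A" and B: "riemann_surface B" and f: "holo_map A B f"
    and s: "s \<in> nbhd A k" "f s \<in> nbhd B l"
    and \<phi>: "(\<lambda>x. \<phi> (chart_inv B l x)) field_differentiable at (coord B l (f s))"
  shows "deriv (\<lambda>z. \<phi> (f (chart_inv A k z))) (coord A k s) =
     deriv (\<lambda>x. \<phi> (chart_inv B l x)) (coord B l (f s)) *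
     deriv (\<lambda>z. coord B l (f (chart_inv A k z))) (coord A k s)"
proof -
  let ?x = "\<lambda>z. coord B l (f (chart_inv A k z))"
  have x: "?x field_differentiable at (coord A k s)"
    using holo_map_analytic[OF A B f s] by (rule analytic_on_imp_differentiable_at) simp
  have "open (f -` nbhd B l)"
    using f riemann_surface_chart(1)[OF B] unfolding holo_map_def by (intro open_vimage) auto
  then have o: "open (coord A k ` (nbhd A k \<inter> f -` nbhd B l))" by (rule open_coord_image[OF A])
  have "deriv (\<lambda>z. \<phi> (f (chart_inv A k z))) (coord A k s) =
      deriv ((\<lambda>x. \<phi> (chart_inv B l x)) \<circ> ?x) (coord A k s)"
    using o s riemann_surface_chart(5)[OF A] riemann_surface_chart(5)[OF B]
    by (intro deriv_cong_open[OF o]) auto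
  also have "\<dots> = deriv (\<lambda>x. \<phi> (chart_inv B l x)) (coord B l (f s)) * deriv ?x (coord A k s)"
    using \<phi> x riemann_surface_chart(5)[OF A s(1)] by (subst deriv_chain) auto
  finally show ?thesis .
qed

text \<open>\<open>W01\<close> is defined through an arbitrarily chosen chart of the base and a
  removal of singularities. Where the fibre coordinate is finite there is nothing to remove, and the
  transition law of the fibre coordinate compensates that of \<open>dx\<close>, so any chart may be
  used.\<close>

lemma W01_eq:
  assumes B: "riemann_surface B" and A: "riemann_surface A" and \<nu>: "holo_to_cotangent B A \<nu>"
    and s: "s \<in> nbhd B k" "fst (\<nu> s) \<in> nbhd A \<alpha>" "snd (\<nu> s) \<alpha> = Some v"
  shows "W01 B A \<nu> k s = v * deriv (\<lambda>z. coord A \<alpha> (fst (\<nu> (chart_inv B k z)))) (coord B k s)"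
proof -
  define i where "i = chart_at A (fst (\<nu> s))"
  have i: "fst (\<nu> s) \<in> nbhd A i" unfolding i_def by (rule chart_at_mem[OF A])
  have \<pi>: "holo_map B A (\<lambda>s. fst (\<nu> s))"
    using \<nu> unfolding holo_to_cotangent_def by (simp add: comp_def)
  have "\<nu> s \<in> compactified_cotangent A" using \<nu> unfolding holo_to_cotangent_def by blast
  then have "(\<forall>i. fst (\<nu> s) \<in> nbhd A i \<longrightarrow> snd (\<nu> s) i = None) \<or>
      (\<exists>v. (\<forall>i. fst (\<nu> s) \<in> nbhd A i \<longrightarrow> snd (\<nu> s) i = Some (v i)) \<and>
         (\<forall>i j. fst (\<nu> s) \<in> nbhd A i \<inter> nbhd A j \<longrightarrow> v j = v i * trans_deriv A i j (fst (\<nu> s))))"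
    unfolding compactified_cotangent_def by (simp add: case_prod_unfold)
  moreover have "\<not> (\<forall>i. fst (\<nu> s) \<in> nbhd A i \<longrightarrow> snd (\<nu> s) i = None)"
    using s(2,3) by (metis option.distinct(1))
  ultimately obtain y where y: "\<And>i. fst (\<nu> s) \<in> nbhd A i \<Longrightarrow> snd (\<nu> s) i = Some (y i)"
      "\<And>i j. fst (\<nu> s) \<in> nbhd A i \<inter> nbhd A j \<Longrightarrow> y j = y i * trans_deriv A i j (fst (\<nu> s))"
    by blast
  define vi where "vi = y i"
  have vi: "snd (\<nu> s) i = Some vi" "v = vi * trans_deriv A i \<alpha> (fst (\<nu> s))"
    using y(1)[OF i] y(1)[OF s(2)] y(2)[of i \<alpha>] i s(2,3) by (simp_all add: vi_def)
  \<comment> \<open>Finiteness is an open condition, so the fibre coordinate is holomorphic in a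
    neighbourhood of \<open>s\<close>.\<close>
  define Fin where "Fin = {s. fst (\<nu> s) \<in> nbhd A i \<and> snd (\<nu> s) i \<noteq> None}"
  have Fin: "open Fin" "holo_fun B Fin (\<lambda>s. the (snd (\<nu> s) i))" "s \<in> Fin"
    using \<nu> i vi unfolding holo_to_cotangent_def Let_def Fin_def by auto
  have "(\<lambda>z. the (snd (\<nu> (chart_inv B k z)) i)) holomorphic_on coord B k ` (nbhd B k \<inter> Fin)"
    using Fin(2) unfolding holo_fun_def by blast
  then have y: "(\<lambda>z. the (snd (\<nu> (chart_inv B k z)) i)) analytic_on {coord B k s}"
    using open_coord_image[OF B Fin(1), of k] s(1) Fin(3) by (auto simp: analytic_at)
  have x: "(\<lambda>z. coord A i (fst (\<nu> (chart_inv B k z)))) analytic_on {coord B k s}"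
    using holo_map_analytic[OF B A \<pi> s(1) i] .
  have "(\<lambda>z. the (snd (\<nu> (chart_inv B k z)) i) *
      deriv (\<lambda>z. coord A i (fst (\<nu> (chart_inv B k z)))) z) analytic_on {coord B k s}"
    by (intro analytic_intros y analytic_deriv x)
  then have "W01 B A \<nu> k s = vi * deriv (\<lambda>z. coord A i (fst (\<nu> (chart_inv B k z)))) (coord B k s)"
    unfolding W01_def Let_def i_def[symmetric]
    using riemann_surface_chart(5)[OF B s(1)] vi by simp
  also have "deriv (\<lambda>z. coord A i (fst (\<nu> (chart_inv B k z)))) (coord B k s) =
      trans_deriv A i \<alpha> (fst (\<nu> s)) * deriv (\<lambda>z. coord A \<alpha> (fst (\<nu> (chart_inv B k z)))) (coord B k s)"
    unfolding trans_deriv_def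
    by (intro deriv_comp_holo_map[OF B A \<pi> s(1,2)]
        analytic_on_imp_differentiable_at[OF holo_map_analytic[OF A A holo_map_ident[OF A] s(2) i]]) simp
  finally show ?thesis using vi(2) by simp
qed

text \<open>The involution negates the fibre coordinate and preserves the base point, so it pulls
  \<open>W01\<close> back to its negative.\<close>

lemma Omega_eq:
  assumes B: "riemann_surface B" and A: "riemann_surface A" and \<nu>: "holo_to_cotangent B A \<nu>"
    and \<sigma>: "galois_involution B \<nu> \<sigma>"
    and s: "s \<in> nbhd B k" "fst (\<nu> s) \<in> nbhd A \<alpha>" "snd (\<nu> s) \<alpha> = Some v"
  shows "Omega B A \<nu> \<sigma> k s = - 2 * v * deriv (\<lambda>z. coord A \<alpha> (fst (\<nu> (chart_inv B k z)))) (coord B k s)"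
proof -
  define j where "j = chart_at B (\<sigma> s)"
  have j: "\<sigma> s \<in> nbhd B j" unfolding j_def by (rule chart_at_mem[OF B])
  have neg: "fst (\<nu> (\<sigma> t)) = fst (\<nu> t)" "snd (\<nu> (\<sigma> t)) \<alpha> = map_option uminus (snd (\<nu> t) \<alpha>)" for t
    using \<sigma> unfolding galois_involution_def negate_fibre_def by auto
  have \<pi>: "holo_map B A (\<lambda>s. fst (\<nu> s))"
    using \<nu> unfolding holo_to_cotangent_def by (simp add: comp_def)
  have "pullback_form B B \<sigma> (W01 B A \<nu>) k s =
      - v * (deriv (\<lambda>z. coord A \<alpha> (fst (\<nu> (chart_inv B j z)))) (coord B j (\<sigma> s)) *
        deriv (\<lambda>z. coord B j (\<sigma> (chart_inv B k z))) (coord B k s))"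
    unfolding pullback_form_def Let_def j_def[symmetric]
    using W01_eq[OF B A \<nu> j, of \<alpha> "- v"] s neg by simp
  \<comment> \<open>The chart at the image point disappears by the chain rule; what remains is the
    base coordinate along the involution, which is the base coordinate itself.\<close>
  also have "deriv (\<lambda>z. coord A \<alpha> (fst (\<nu> (chart_inv B j z)))) (coord B j (\<sigma> s)) *
        deriv (\<lambda>z. coord B j (\<sigma> (chart_inv B k z))) (coord B k s) =
      deriv (\<lambda>z. coord A \<alpha> (fst (\<nu> (\<sigma> (chart_inv B k z))))) (coord B k s)"
  proof (rule deriv_comp_holo_map[where f = \<sigma> and \<phi> = "\<lambda>t. coord A \<alpha> (fst (\<nu> t))",
        OF B B _ s(1) j, symmetric])
    show "holo_map B B \<sigma>" using \<sigma> unfolding galois_involution_def by blast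
    show "(\<lambda>x. coord A \<alpha> (fst (\<nu> (chart_inv B j x)))) field_differentiable at (coord B j (\<sigma> s))"
      using analytic_on_imp_differentiable_at[OF holo_map_analytic[OF B A \<pi> j]] s neg by simp
  qed
  finally show ?thesis
    unfolding Omega_def using W01_eq[OF B A \<nu> s] neg by simp
qed

text \<open>Holomorphy of the prime form is stated on sheets, while the local coordinate uses a
  global \<open>lift\<close>. Near each point a sheet is needed on which \<open>lift\<close> is the
  inverse of \<open>pr\<close>.\<close>

lemma section_sheet:
  assumes pr: "universal_covering pr" and W: "open W" "continuous_on W lift"
    and lift: "\<And>s. s \<in> W \<Longrightarrow> pr (lift s) = s" and s: "s \<in> W"
  obtains T where "open T" "lift s \<in> T" "inj_on pr T" "pr ` T = W \<inter> lift -` T"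
    "\<And>t. t \<in> T \<Longrightarrow> lift (pr t) = t"
proof -
  have cov: "covering_space UNIV pr UNIV" using pr unfolding universal_covering_def by blast
  then have cont: "continuous_on UNIV pr" by (rule covering_space_imp_continuous)
  obtain T0 u q where T0: "lift s \<in> T0" "open T0" "homeomorphism T0 u pr q"
    by (rule covering_space_local_homeomorphism[OF cov, of "lift s"]) auto
  then have inj: "inj_on pr T0" by (metis homeomorphism_def inj_on_inverseI)
  define V where "V = W \<inter> lift -` T0"
  have V: "open V" using W T0(2) by (simp add: V_def continuous_open_preimage)
  \<comment> \<open>On \<open>T0\<close> alone \<open>lift\<close> might jump to another sheet;
    restricting to points whose image is lifted back into \<open>T0\<close> excludes this.\<close>
  define T where "T = T0 \<inter> pr -` V"
  have sec: "lift (pr t) = t" if "t \<in> T" for t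
    using that lift inj unfolding T_def V_def inj_on_def by (metis IntE vimageE)
  show ?thesis
  proof (rule that)
    show "open T" unfolding T_def using T0(2) open_vimage[OF V cont] by blast
    show "lift s \<in> T" using T0 s lift by (simp add: T_def V_def)
    show "inj_on pr T" using inj unfolding T_def by (rule inj_on_subset) blast
    show "lift (pr t) = t" if "t \<in> T" for t by (rule sec[OF that])
    show "pr ` T = W \<inter> lift -` T"
      using sec lift by (auto simp: T_def V_def) (metis IntI imageI vimageI)
  qed
qed

text \<open>Near each point \<open>lift\<close> agrees with an inverse branch on a sheet, which
  transfers holomorphy. The derivative is -1 because the normalization compares with
  \<open>x(u) - x(v)\<close> and the second argument varies.\<close>

lemma
  assumes A: "riemann_surface A" and pr: "universal_covering pr" and E: "prime_form A \<xi> g a b pr E"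
    and lift: "continuous_on (nbhd A k) lift" "\<And>s. s \<in> nbhd A k \<Longrightarrow> pr (lift s) = s"
    and w: "w \<in> cimage A k"
  shows local_prime_holomorphic: "local_prime A k lift E w holomorphic_on cimage A k"
    and local_prime_eq_0_iff: "z \<in> cimage A k \<Longrightarrow> local_prime A k lift E w z = 0 \<longleftrightarrow> z = w"
    and local_prime_has_derivative: "(local_prime A k lift E w has_field_derivative - 1) (at w)"
proof -
  note ch = riemann_surface_chart[OF A]
  note hol = E[unfolded prime_form_def, THEN conjunct2, THEN conjunct2, THEN conjunct1, rule_format]
  note vanish = E[unfolded prime_form_def, 
      THEN conjunct2, THEN conjunct2, THEN conjunct2, THEN conjunct2, THEN conjunct2, THEN conjunct1, rule_format]
  note norm = E[unfolded prime_form_def, 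
      THEN conjunct2, THEN conjunct2, THEN conjunct2, THEN conjunct2, THEN conjunct2, THEN conjunct2, THEN conjunct1, rule_format]
  define L where "L = (\<lambda>z. lift (chart_inv A k z))"
  have L: "pr (L z) = chart_inv A k z" "pr (L z) \<in> nbhd A k" "coord A k (pr (L z)) = z" if "z \<in> cimage A k" for z
    using that ch lift unfolding L_def by auto
  have e: "local_prime A k lift E w = (\<lambda>z. E k k (L w) (L z))"
    by (simp add: local_prime_def L_def fun_eq_iff)
  show iff: "local_prime A k lift E w z = 0 \<longleftrightarrow> z = w" if "z \<in> cimage A k" for z
  proof -
    have "pr (L w) = pr (L z) \<longleftrightarrow> z = w" using L(3)[OF w] L(3)[OF that] by metis
    then show ?thesis unfolding e using vanish[OF conjI[OF L(2)[OF w] L(2)[OF that]]] by simp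
  qed
  have "local_prime A k lift E w field_differentiable at z" if z: "z \<in> cimage A k" for z
  proof -
    obtain T where T: "open T" "L z \<in> T" "inj_on pr T" "pr ` T = nbhd A k \<inter> lift -` T"
      "\<And>t. t \<in> T \<Longrightarrow> lift (pr t) = t"
      using section_sheet[OF pr ch(1) lift ch(7)[OF z]] unfolding L_def by blast
    have sh: "sheet A pr k T" using T unfolding sheet_def by auto
    have o: "open (coord A k ` pr ` T)"
    proof -
      have "open (nbhd A k \<inter> lift -` T)" using ch(1) lift(1) T(1) by (simp add: continuous_open_preimage)
      then have "open (pr ` T)" unfolding T(4) .
      moreover have "nbhd A k \<inter> pr ` T = pr ` T" using T(4) by blast
      ultimately show ?thesis using open_coord_image[OF A, of "pr ` T" k] by simp
    qed
    have zT: "z \<in> coord A k ` pr ` T" using L(3)[OF z] T(2) by (metis imageI)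
    have "(\<lambda>x. E k k (L w) (sheet_inv A pr k T x)) holomorphic_on coord A k ` pr ` T"
      by (rule hol[OF conjI[OF L(2)[OF w] sh]])
    moreover have "sheet_inv A pr k T x = L x" if x: "x \<in> coord A k ` pr ` T" for x
    proof -
      obtain t where t: "t \<in> T" "x = coord A k (pr t)" using x by blast
      then have "pr t \<in> nbhd A k" using T(4) by blast
      then have "chart_inv A k x = pr t" using t ch(5) by simp
      then show ?thesis using t T(3,5) by (simp add: sheet_inv_def L_def)
    qed
    ultimately have "local_prime A k lift E w holomorphic_on coord A k ` pr ` T"
      unfolding e by (simp cong: holomorphic_cong)
    then show ?thesis using o zT holomorphic_on_imp_differentiable_at by blast
  qed
  then show "local_prime A k lift E w holomorphic_on cimage A k"
    by (simp add: holomorphic_on_def field_differentiable_at_within)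
  have "continuous_on (cimage A k) L"
    unfolding L_def by (rule continuous_on_compose2[OF lift(1) ch(4)]) (use ch(7) in auto)
  then have "(L \<longlongrightarrow> L w) (at w)"
    using continuous_on_interior[of "cimage A k" L w] w ch(2)[of k]
    by (simp only: interior_open isCont_def)
  moreover have ev: "eventually (\<lambda>z. z \<in> cimage A k \<and> z \<noteq> w) (at w)"
    using eventually_at_in_open[OF ch(2) w] by eventually_elim auto
  \<comment> \<open>The limit upstairs is over a punctured neighbourhood, so the lifted path must
    avoid its limit point.\<close>
  then have "eventually (\<lambda>z. L z \<noteq> L w) (at w)"
    by eventually_elim (metis L(3) w)
  ultimately have fl: "filterlim L (at (L w)) (at w)" by (simp add: filterlim_at)
  have "((\<lambda>v. E k k (L w) v / (coord A k (pr (L w)) - coord A k (pr v))) \<longlongrightarrow> 1) (at (L w))"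
    by (rule norm[OF L(2)[OF w]])
  from tendsto_minus[OF filterlim_compose[OF this fl]]
  have lim: "((\<lambda>z. - (E k k (L w) (L z) / (w - coord A k (pr (L z))))) \<longlongrightarrow> - 1) (at w)"
    unfolding L(3)[OF w] .
  have "((\<lambda>z. (local_prime A k lift E w z - local_prime A k lift E w w) / (z - w)) \<longlongrightarrow> - 1) (at w)"
  proof (rule Lim_transform_eventually[OF lim])
    show "\<forall>\<^sub>F z in at w. - (E k k (L w) (L z) / (w - coord A k (pr (L z)))) =
      (local_prime A k lift E w z - local_prime A k lift E w w) / (z - w)"
      using ev
    proof eventually_elim
      case (elim z)
      have "local_prime A k lift E w w = 0" using iff[OF w] by simp
      then show ?case unfolding e using L(3)[of z] elim
        by (simp add: minus_divide_right)
    qed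
  qed
  then show "(local_prime A k lift E w has_field_derivative - 1) (at w)"
    by (simp add: has_field_derivative_iff)
qed

section \<open>The WKB equations\<close>

text \<open>Only the indices 0, 1, \<open>K - 1\<close> and \<open>K\<close> involve an unstable
  factor; they are distinct because \<open>K >= 3\<close>.\<close>

lemma sum_convolution_split:
  fixes x :: "nat \<Rightarrow> complex"
  assumes "K \<ge> 3"
  defines "y \<equiv> \<lambda>k. if k < 2 then 0 else x k"
  shows "(\<Sum>k\<le>K. x k * x (K - k)) = 2 * x 0 * x K + 2 * x 1 * x (K - 1) + (\<Sum>k\<le>K. y k * y (K - k))"
proof -
  have "(\<Sum>k\<le>K. x k * x (K - k) - y k * y (K - k)) = (\<Sum>k\<in>{0, 1, K - 1, K}. x k * x (K - k) - y k * y (K - k))"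
    using assms(1) by (intro sum.mono_neutral_right) (auto simp: y_def)
  also have "\<dots> = 2 * x 0 * x K + 2 * x 1 * x (K - 1)"
    using assms(1) by (simp add: y_def)
  finally show ?thesis by (simp add: sum_subtractf algebra_simps)
qed

text \<open>Order 0 in h-bar is the eikonal equation; order \<open>m + 1\<close> is the equation
  indexed by \<open>m\<close>, since q contributes only at order 0.\<close>

lemma wkb_solution_rees_generator:
  assumes S0: "\<And>x. x \<in> N \<Longrightarrow> (deriv (S 0) x)\<^sup>2 - coef A q i x = 0"
    and S: "\<And>m x. x \<in> N \<Longrightarrow>
      deriv (deriv (S m)) x + (\<Sum>k\<le>m + 1. deriv (S k) x * deriv (S (m + 1 - k)) x) = 0"
  shows "wkb_solution (rees_generator A q i) S N"
  unfolding wkb_solution_def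
proof (intro allI ballI)
  fix k x assume x: "x \<in> N"
  let ?\<phi> = "\<lambda>k (x::complex). if k = 0 then 1 else 0 :: complex"
  \<comment> \<open>On the constant amplitude 1 only the term with \<open>m = k\<close>
    survives.\<close>
  have 1: "wkb_hbar_ddx S ?\<phi> = (\<lambda>k. deriv (S k))"
  proof (intro ext)
    fix k x
    have "(\<Sum>m\<le>k. deriv (S m) x * ?\<phi> (k - m) x) = (\<Sum>m\<in>{k}. deriv (S m) x * ?\<phi> (k - m) x)"
      by (intro sum.mono_neutral_right) auto
    then show "wkb_hbar_ddx S ?\<phi> k x = deriv (S k) x" by (simp add: wkb_hbar_ddx_def)
  qed
  have 2: "(wkb_hbar_ddx S ^^ 2) ?\<phi> k x =
      (if k = 0 then 0 else deriv (deriv (S (k - 1))) x) + (\<Sum>m\<le>k. deriv (S m) x * deriv (S (k - m)) x)"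
    by (simp add: numeral_2_eq_2 1) (simp add: wkb_hbar_ddx_def)
  have "wkb_apply (rees_generator A q i) S ?\<phi> k x =
      - coef A q i x * ?\<phi> k x + (wkb_hbar_ddx S ^^ 2) ?\<phi> k x"
    by (simp add: wkb_apply_def rees_generator_def numeral_2_eq_2)
  also have "\<dots> = 0"
  proof (cases k)
    case 0
    then show ?thesis unfolding 2 using S0[OF x] by (simp add: power2_eq_square)
  next
    case (Suc m)
    then show ?thesis unfolding 2 using S[OF x, of m] by simp
  qed
  finally show "wkb_apply (rees_generator A q i) S ?\<phi> k x = 0" .
qed

text \<open>Upstairs both the second derivative and the derivative of \<open>Om\<close> produce
  second derivatives of the covering map. These cancel, because \<open>Om\<close> is proportional to
  the pullback of \<open>dS_0\<close>, and the rest is the downstairs equation times the square of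
  the nonzero \<open>X\<close>.\<close>

lemma wkb_change_of_variable:
  fixes T :: "nat \<Rightarrow> complex \<Rightarrow> complex"
  assumes U: "open U" "w \<in> U" and N: "open N" "\<xi> ` U \<subseteq> N"
    and \<xi>: "\<xi> holomorphic_on U" "deriv \<xi> w \<noteq> 0"
    and S: "\<And>m. S m holomorphic_on N"
    and S0: "deriv (S 0) (\<xi> w) \<noteq> 0"
    and S1: "deriv (deriv (S 0)) (\<xi> w) + 2 * deriv (S 0) (\<xi> w) * deriv (S 1) (\<xi> w) = 0"
    and T: "\<And>m z. m \<ge> 2 \<Longrightarrow> z \<in> U \<Longrightarrow> T m z = S m (\<xi> z)"
    and Om: "\<And>z. z \<in> U \<Longrightarrow> Om z = - 2 * deriv (S 0) (\<xi> z) * deriv \<xi> z"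
    and M: "M \<ge> 2"
    and rec: "Om w * deriv (T (Suc M)) w =
     deriv (deriv (T M)) w - deriv Om w / Om w * deriv (T M) w +
     (\<Sum>j\<le>Suc M. (if j < 2 then 0 else deriv (T j) w) *
        (if Suc M - j < 2 then 0 else deriv (T (Suc M - j)) w))"
  shows "deriv (deriv (S M)) (\<xi> w) +
    (\<Sum>k\<le>M + 1. deriv (S k) (\<xi> w) * deriv (S (M + 1 - k)) (\<xi> w)) = 0"
proof -
  note d = holomorphic_derivI[OF _ U(1)]
  have \<xi>N: "\<xi> z \<in> N" if "z \<in> U" for z using N that by blast
  have comp: "((\<lambda>z. f (\<xi> z)) has_field_derivative deriv f (\<xi> z) * deriv \<xi> z) (at z)"
    if "f holomorphic_on N" "z \<in> U" for f z
    using DERIV_chain2[OF holomorphic_derivI[OF that(1) N(1) \<xi>N[OF that(2)]] d[OF \<xi>(1) that(2)]] .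
  have S': "deriv (S m) holomorphic_on N" for m using S N(1) by (rule holomorphic_deriv)
  have \<xi>': "(deriv \<xi> has_field_derivative deriv (deriv \<xi>) w) (at w)"
    using holomorphic_deriv[OF \<xi>(1) U(1)] U(2) by (rule d)
  define X where "X = deriv \<xi> w"
  define X' where "X' = deriv (deriv \<xi>) w"
  define s where "s = (\<lambda>m. deriv (S m) (\<xi> w))"
  define s' where "s' = (\<lambda>m. deriv (deriv (S m)) (\<xi> w))"
  have dT: "deriv (T m) z = deriv (S m) (\<xi> z) * deriv \<xi> z" if "m \<ge> 2" "z \<in> U" for m z
  proof -
    have "deriv (T m) z = deriv (\<lambda>z. S m (\<xi> z)) z"
      using T that by (intro deriv_cong_open[OF U(1)]) auto
    then show ?thesis using DERIV_imp_deriv[OF comp[OF S that(2)]] by simp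
  qed
  have prod: "deriv (\<lambda>z. deriv (S m) (\<xi> z) * deriv \<xi> z) w = s' m * X\<^sup>2 + s m * X'" for m
    using DERIV_imp_deriv[OF DERIV_mult[OF comp[OF S' U(2)] \<xi>']]
    by (simp add: s_def s'_def X_def X'_def power2_eq_square algebra_simps)
  have ddT: "deriv (deriv (T M)) w = s' M * X\<^sup>2 + s M * X'"
    unfolding prod[symmetric] using dT[OF M] by (intro deriv_cong_open[OF U]) auto
  have "deriv Om w = deriv (\<lambda>z. - 2 * (deriv (S 0) (\<xi> z) * deriv \<xi> z)) w"
    using Om by (intro deriv_cong_open[OF U]) auto
  also have "\<dots> = - 2 * (s' 0 * X\<^sup>2 + s 0 * X')"
    unfolding prod[symmetric]
    by (intro DERIV_imp_deriv DERIV_cmult DERIV_deriv_iff_field_differentiable[THEN iffD2])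
      (use DERIV_mult[OF comp[OF S' U(2)] \<xi>'] in \<open>auto simp: field_differentiable_def\<close>)
  finally have dOm: "deriv Om w = - 2 * (s' 0 * X\<^sup>2 + s 0 * X')" .
  have nz: "X \<noteq> 0" "s 0 \<noteq> 0" using \<xi>(2) S0 by (auto simp: X_def s_def)
  have conv: "(\<Sum>j\<le>Suc M. (if j < 2 then 0 else deriv (T j) w) *
        (if Suc M - j < 2 then 0 else deriv (T (Suc M - j)) w)) =
     X\<^sup>2 * (\<Sum>j\<le>Suc M. (if j < 2 then 0 else s j) * (if Suc M - j < 2 then 0 else s (Suc M - j)))"
    unfolding sum_distrib_left
    by (intro sum.cong refl) (simp add: dT U(2) s_def X_def power2_eq_square mult_ac)
  have s0': "s' 0 = - 2 * s 0 * s 1" using S1 by (simp add: s_def s'_def add_eq_0_iff)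
  let ?c = "\<Sum>j\<le>Suc M. (if j < 2 then 0 else s j) * (if Suc M - j < 2 then 0 else s (Suc M - j))"
  have "- 2 * s 0 * X * (s (Suc M) * X) = s' M * X\<^sup>2 + s M * X' -
      (- 2 * (s' 0 * X\<^sup>2 + s 0 * X')) / (- 2 * s 0 * X) * (s M * X) + X\<^sup>2 * ?c"
    using rec unfolding ddT dOm conv using Om[OF U(2)] dT[of M, OF _ U(2)] dT[of "Suc M", OF _ U(2)] M
    by (simp add: s_def X_def)
  \<comment> \<open>The logarithmic derivative of \<open>Om\<close> is
    \<open>s' 0 / s 0 * X + X' / X\<close>. The equation for \<open>S 1\<close> makes the first part
    \<open>- 2 * s 1 * X\<close>; the second cancels the \<open>X'\<close> in the second derivative
    of \<open>T M\<close>.\<close>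
  also have "(- 2 * (s' 0 * X\<^sup>2 + s 0 * X')) / (- 2 * s 0 * X) * (s M * X) = s M * X' - 2 * s 1 * s M * X\<^sup>2"
    unfolding s0' using nz by (simp add: divide_simps) (simp add: algebra_simps)
  finally have eq: "- 2 * s 0 * X * (s (Suc M) * X) =
      s' M * X\<^sup>2 + s M * X' - (s M * X' - 2 * s 1 * s M * X\<^sup>2) + X\<^sup>2 * ?c" .
  \<comment> \<open>Stated for arbitrary \<open>C\<close> so that the algebra treats the convolution
    as an atom.\<close>
  have "X\<^sup>2 * (s' M + (2 * s 0 * s (Suc M) + 2 * s 1 * s M + C)) =
      (s' M * X\<^sup>2 + s M * X' - (s M * X' - 2 * s 1 * s M * X\<^sup>2) + X\<^sup>2 * C) -
      (- 2 * s 0 * X * (s (Suc M) * X))" for C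
    by (simp add: algebra_simps power2_eq_square)
  from this[of ?c] have "X\<^sup>2 * (s' M + (2 * s 0 * s (Suc M) + 2 * s 1 * s M + ?c)) = 0"
    unfolding eq by simp
  then have "s' M + (2 * s 0 * s (Suc M) + 2 * s 1 * s (Suc M - 1) + ?c) = 0" using nz by simp
  then show ?thesis
    using sum_convolution_split[of "Suc M" s] M
    by (simp only: add.assoc s_def s'_def Suc_eq_plus1[symmetric])
qed

theorem theorem6p1:
  fixes AC :: "('i, 'c::t2_space) atlas"
    and AS :: "('j, 's::t2_space) atlas"
    and \<xi>C :: "'i \<Rightarrow> 'i \<Rightarrow> 'c \<Rightarrow> complex"
    and \<xi>S :: "'j \<Rightarrow> 'j \<Rightarrow> 's \<Rightarrow> complex"
    and D :: "'c \<Rightarrow> nat"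
    and q :: "'i \<Rightarrow> 'c \<Rightarrow> complex"
    and \<nu> :: "'s \<Rightarrow> ('i, 'c) cotangent_point"
    and \<sigma> :: "'s \<Rightarrow> 's"
    and gC gS :: nat
    and aC bC :: "nat \<Rightarrow> real \<Rightarrow> 'c"
    and aS bS :: "nat \<Rightarrow> real \<Rightarrow> 's"
    and pr :: "'u::t2_space \<Rightarrow> 's"
    and E :: "'j \<Rightarrow> 'j \<Rightarrow> 'u \<Rightarrow> 'u \<Rightarrow> complex"
    and p :: 'c and \<alpha> :: 'i and \<zeta> :: 'j
    and lift :: "'s \<Rightarrow> 'u"
    and N :: "complex set"
    and zsec :: "complex \<Rightarrow> complex"
    and S :: "nat \<Rightarrow> complex \<Rightarrow> complex"
    and F :: "nat \<Rightarrow> complex list \<Rightarrow> complex"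
    and \<Phi> :: "complex list \<Rightarrow> complex"
    and f :: "complex \<Rightarrow> complex"
  defines "\<pi> \<equiv> fst \<circ> \<nu>"
    and "sg \<equiv> \<lambda>z. coord AS \<zeta> (\<sigma> (chart_inv AS \<zeta> z))"
    and "xz \<equiv> \<lambda>z. coord AC \<alpha> (fst (\<nu> (chart_inv AS \<zeta> z)))"
    and "Om \<equiv> \<lambda>z. Omega AS AC \<nu> \<sigma> \<zeta> (chart_inv AS \<zeta> z)"
    and "e \<equiv> local_prime AS \<zeta> lift E"
    and "U \<equiv> zsec ` N"
  assumes curve: "compact_riemann_surface AC" "projective_coordinates AC"
      "theta_characteristic AC \<xi>C"
    and quad: "effective_divisor D" "quadratic_differential AC D q"
    and spectral: "normalization AS AC (spectral_curve AC q) \<nu>"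
      "galois_involution AS \<nu> \<sigma>"
    and homology: "symplectic_basis AC gC aC bC" "symplectic_basis AS gS aS bS"
      "gC \<le> gS" "\<forall>j<gC. homologous_loops (\<pi> \<circ> aS j) (aC j)"
    and theta: "theta_characteristic AS \<xi>S" "gS > 0 \<Longrightarrow> one_dim_sections AS \<xi>S"
    and prime: "universal_covering pr" "prime_form AS \<xi>S gS aS bS pr E"
    and point: "odd_order_point AC q \<alpha> p"
      "\<And>c. c \<in> nbhd AC \<alpha> - {p} \<Longrightarrow>
         \<not> is_pole (coef AC q \<alpha>) (coord AC \<alpha> c) \<and> q \<alpha> c \<noteq> 0"
    and preimage: "nbhd AS \<zeta> = \<pi> -` nbhd AC \<alpha>"
    and lift_choice: "continuous_on (nbhd AS \<zeta>) lift" "\<And>s. s \<in> nbhd AS \<zeta> \<Longrightarrow> pr (lift s) = s"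
    and loc_section: "open N" "N \<subseteq> coord AC \<alpha> ` (nbhd AC \<alpha> - {p})" "zsec holomorphic_on N"
      "\<And>x. x \<in> N \<Longrightarrow> zsec x \<in> cimage AS \<zeta> \<and> xz (zsec x) = x"
    and S_holo: "S 0 holomorphic_on N" "S 1 holomorphic_on N" "S 2 holomorphic_on N"
    and S0_section: "\<And>x. x \<in> N \<Longrightarrow>
         snd (\<nu> (chart_inv AS \<zeta> (zsec x))) \<alpha> = Some (deriv (S 0) x)"
    and S0: "\<And>x. x \<in> N \<Longrightarrow> (deriv (S 0) x)\<^sup>2 - coef AC q \<alpha> x = 0"
    and S1: "\<And>x. x \<in> N \<Longrightarrow> deriv (deriv (S 0)) x + 2 * deriv (S 0) x * deriv (S 1) x = 0"
    and S2: "\<And>x. x \<in> N \<Longrightarrow>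
         deriv (deriv (S 1)) x + 2 * deriv (S 2) x * deriv (S 0) x + (deriv (S 1) x)\<^sup>2 = 0"
    and F11: "\<And>z. z \<in> U \<Longrightarrow>
         ((\<lambda>u. F 1 [u]) has_field_derivative - (W02s e sg z z / Om z)) (at z)"
    and Phi: "multi_holomorphic U 3 \<Phi>"
      "\<And>z1 z2 z3. z1 \<in> U \<Longrightarrow> z2 \<in> U \<Longrightarrow> z3 \<in> U \<Longrightarrow> z1 \<noteq> z2 \<Longrightarrow> z1 \<noteq> z3 \<Longrightarrow>
         deriv (\<lambda>t1. deriv (\<lambda>t2. deriv (\<lambda>t3. \<Phi> [t1, t2, t3]) z3) z2) z1 = W03 e sg Om z1 z2 z3"
    and f: "\<And>z. z \<in> U \<Longrightarrow> f z = S 2 (xz z) - (F 1 [z] - 1 / 6 * \<Phi> [z, z, z])"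
    and F03: "\<And>z1 z2 z3. z1 \<in> U \<Longrightarrow> z2 \<in> U \<Longrightarrow> z3 \<in> U \<Longrightarrow>
         F 0 [z1, z2, z3] = - \<Phi> [z1, z2, z3] + 2 * (f z1 + f z2 + f z3)"
    and F_functions: "\<And>g n. n \<ge> 1 \<Longrightarrow> 2 * int g - 2 + int n \<ge> 1 \<Longrightarrow>
         multi_holomorphic U n (F g) \<and> multi_symmetric U n (F g)"
    and recursion: "pde_recursion U sg Om (omega e) F"
    and Sm: "\<And>m x. m \<ge> 3 \<Longrightarrow> x \<in> N \<Longrightarrow>
         S m x = (\<Sum>(g, n) \<in> {(g, n). n \<ge> 1 \<and> 2 * int g - 2 + int n = int m - 1}.
                    1 / fact n * F g (replicate n (zsec x)))"
  shows "(\<forall>x\<in>N. S 2 x = F 1 [zsec x] + 1 / 6 * F 0 [zsec x, zsec x, zsec x]) \<and>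
         wkb_solution (rees_generator AC q \<alpha>) S N \<and>
         (\<forall>m\<ge>2. \<forall>x\<in>N.
            deriv (deriv (S m)) x + (\<Sum>k\<le>m + 1. deriv (S k) x * deriv (S (m + 1 - k)) x) = 0)"
proof -
  have RC: "riemann_surface AC" using curve(1) unfolding compact_riemann_surface_def by blast
  have RS: "riemann_surface AS" and \<nu>: "holo_to_cotangent AS AC \<nu>"
    using spectral(1) unfolding normalization_def compact_riemann_surface_def by blast+
  note chC = riemann_surface_chart[OF RC] and chS = riemann_surface_chart[OF RS]
  have \<pi>: "holo_map AS AC (\<lambda>s. fst (\<nu> s))"
    using \<nu> unfolding holo_to_cotangent_def by (simp add: comp_def)
  have over: "fst (\<nu> s) \<in> nbhd AC \<alpha>" if "s \<in> nbhd AS \<zeta>" for s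
    using preimage that by (auto simp: \<pi>_def)
  have xz_hol: "xz holomorphic_on cimage AS \<zeta>"
  proof -
    have "xz field_differentiable at z" if z: "z \<in> cimage AS \<zeta>" for z
      using analytic_on_imp_differentiable_at[OF holo_map_analytic[OF RS RC \<pi> chS(7)[OF z] over[OF chS(7)[OF z]]]]
        chS(6)[OF z] by (simp add: xz_def)
    then show ?thesis by (simp add: holomorphic_on_def field_differentiable_at_within)
  qed
  have UC: "U \<subseteq> cimage AS \<zeta>" using loc_section(4) by (auto simp: U_def)
  have xzN: "xz z \<in> N" "zsec (xz z) = z" if "z \<in> U" for z
    using that loc_section(4) by (auto simp: U_def)
  \<comment> \<open>The section is injective since \<open>xz\<close> undoes it; the open mapping
    theorem then makes its image a coordinate domain on which \<open>xz\<close> is its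
    inverse.\<close>
  have "inj_on zsec N" using loc_section(4) by (metis inj_onI)
  then have U: "open U" unfolding U_def using open_mapping_thm3 loc_section(1,3) by blast
  have xz_hol_U: "xz holomorphic_on U" using xz_hol UC by (rule holomorphic_on_subset)
  have S0_nz: "deriv (S 0) x \<noteq> 0" if x: "x \<in> N" for x
  proof -
    obtain c where c: "c \<in> nbhd AC \<alpha> - {p}" "x = coord AC \<alpha> c" using loc_section(2) x by blast
    then have "coef AC q \<alpha> x \<noteq> 0" using point(2) chC(5) by auto
    then show ?thesis using S0[OF x] by auto
  qed
  have xz_nz: "deriv xz z \<noteq> 0" if z: "z \<in> U" for z
  proof -
    have "deriv (xz \<circ> zsec) (xz z) = deriv xz z * deriv zsec (xz z)"
      using deriv_chain[of zsec "xz z" xz] xzN[OF z] z U loc_section(1,3) xz_hol_U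
      by (simp add: holomorphic_on_imp_differentiable_at)
    moreover have "deriv (xz \<circ> zsec) (xz z) = deriv (\<lambda>x. x) (xz z)"
      using loc_section(4) by (intro deriv_cong_open[OF loc_section(1) xzN(1)[OF z]]) auto
    ultimately show ?thesis by auto
  qed
  have y: "snd (\<nu> (chart_inv AS \<zeta> z)) \<alpha> = Some (deriv (S 0) (xz z))" if "z \<in> U" for z
    using S0_section[OF xzN(1)[OF that]] xzN(2)[OF that] by simp
  have Om: "Om z = - 2 * deriv (S 0) (xz z) * deriv xz z" if z: "z \<in> U" for z
  proof -
    have zC: "z \<in> cimage AS \<zeta>" using z UC by blast
    show ?thesis
      using Omega_eq[OF RS RC \<nu> spectral(2) chS(7)[OF zC] over[OF chS(7)[OF zC]] y[OF z]] chS(6)[OF zC]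
      by (simp add: Om_def xz_def)
  qed
  have Om_nz: "Om z \<noteq> 0" if "z \<in> U" for z
    using Om[OF that] S0_nz[OF xzN(1)[OF that]] xz_nz[OF that] by simp
  have Om_hol: "Om holomorphic_on U"
  proof -
    have "(deriv (S 0) \<circ> xz) holomorphic_on U"
      using xzN by (intro holomorphic_on_compose_gen[OF xz_hol_U holomorphic_deriv[OF S_holo(1) loc_section(1)]]) auto
    then have "(\<lambda>z. - 2 * deriv (S 0) (xz z) * deriv xz z) holomorphic_on U"
      by (intro holomorphic_on_mult holomorphic_on_const holomorphic_deriv[OF xz_hol_U U]) (simp add: comp_def)
    then show ?thesis using Om by (simp cong: holomorphic_cong)
  qed
  \<comment> \<open>The involution preserves the fibres of the projection, so it stays in the chart;
    a fixed point would have fibre coordinate equal to its negative, but that coordinate is nonzero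
    over \<open>N\<close>.\<close>
  have sg: "sg w \<in> cimage AS \<zeta>" "sg w \<noteq> w" if w: "w \<in> U" for w
  proof -
    let ?s = "chart_inv AS \<zeta> w"
    have wC: "w \<in> cimage AS \<zeta>" using w UC by blast
    have neg: "fst (\<nu> (\<sigma> ?s)) = fst (\<nu> ?s)" "snd (\<nu> (\<sigma> ?s)) \<alpha> = map_option uminus (snd (\<nu> ?s) \<alpha>)"
      using spectral(2) unfolding galois_involution_def negate_fibre_def by auto
    have mem: "\<sigma> ?s \<in> nbhd AS \<zeta>" using preimage over[OF chS(7)[OF wC]] neg(1) by (simp add: \<pi>_def)
    then show "sg w \<in> cimage AS \<zeta>" by (simp add: sg_def)
    show "sg w \<noteq> w"
    proof
      assume "sg w = w"
      then have "\<sigma> ?s = ?s" using chS(5)[OF mem] by (simp add: sg_def)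
      then have "- deriv (S 0) (xz w) = deriv (S 0) (xz w)" using neg(2) y[OF w] by simp
      then show False using S0_nz[OF xzN(1)[OF w]] by simp
    qed
  qed
  have om: "((\<lambda>z. omega e w (sg w) z * (h z - h w)) \<longlongrightarrow> h') (at w)"
    if w: "w \<in> U" and h: "(h has_field_derivative h') (at w)" for w h h'
  proof -
    have wC: "w \<in> cimage AS \<zeta>" using w UC by blast
    note loc = RS prime lift_choice
    \<comment> \<open>Thus \<open>e w\<close> has a simple zero at \<open>w\<close>, whereas
      \<open>e (sg w)\<close> does not vanish there.\<close>
    have "deriv (e w) w = - 1"
      unfolding e_def using DERIV_imp_deriv[OF local_prime_has_derivative[OF loc wC]] .
    then show ?thesis
      unfolding omega_def
      using log_derivative_difference_tendsto[OF chS(2) wC local_prime_holomorphic[OF loc wC] _ _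
          local_prime_holomorphic[OF loc sg(1)[OF w]] _ h]
        local_prime_eq_0_iff[OF loc wC wC] local_prime_eq_0_iff[OF loc sg(1)[OF w] wC] sg(2)[OF w]
      by (simp add: e_def)
  qed
  have S2_eq: "S 2 x = F 1 [zsec x] + 1 / 6 * F 0 [zsec x, zsec x, zsec x]" if x: "x \<in> N" for x
  proof -
    have z: "zsec x \<in> U" "xz (zsec x) = x" using x loc_section(4) by (simp_all add: U_def)
    \<comment> \<open>On the diagonal the three terms \<open>2 * f\<close> give
      \<open>6 * f\<close>; the weight 1/6 then restores exactly the correction to
      \<open>S 2\<close> built into \<open>f\<close>.\<close>
    have F0: "F 0 [zsec x, zsec x, zsec x] = - \<Phi> [zsec x, zsec x, zsec x] + 6 * f (zsec x)"
      unfolding F03[OF z(1) z(1) z(1)] by simp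
    show ?thesis unfolding F0 f[OF z(1)] z(2) by (simp add: field_simps)
  qed
  have S_diag_sum: "S m x = diag_sum F m (zsec x)" if "m \<ge> 2" "x \<in> N" for m x
  proof (cases "m = 2")
    case True
    \<comment> \<open>These pairs are \<open>F 0\<close> with weight 1/6 and \<open>F 1\<close> with
      weight 1, so the prescribed \<open>S 2\<close> obeys the same formula as the higher
      terms.\<close>
    have "{(g, k). 2 * g + k = (2::nat)} = {(0, 2), (1, 0)}" by (safe; simp; presburger)
    then show ?thesis
      using True S2_eq[OF that(2)] by (simp add: diag_sum_def numeral_2_eq_2 fact_Suc)
  next
    case False
    then show ?thesis
      using that Sm[of m x] unfolding diag_sum_def by (simp only: sum_over_stable_range)
  qed
  have T: "diag_sum F m z = S m (xz z)" if "m \<ge> 2" "z \<in> U" for m z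
    using S_diag_sum[OF that(1) xzN(1)[OF that(2)]] xzN(2)[OF that(2)] by simp
  have S_hol: "S m holomorphic_on N" for m
  proof (cases "m < 2")
    case True
    then show ?thesis using S_holo by (auto simp: less_2_cases_iff)
  next
    case False
    \<comment> \<open>From index 3 on, holomorphy downstairs is inherited from the diagonal sums
      through the section.\<close>
    then have "diag_sum F m holomorphic_on U"
      using deriv_diag_sum[where F = F and U = U and m = m, OF U F_functions] U by (auto simp: holomorphic_on_open)
    then have "(diag_sum F m \<circ> zsec) holomorphic_on N"
      by (intro holomorphic_on_compose_gen[OF loc_section(3)]) (auto simp: U_def)
    then show ?thesis using S_diag_sum[of m] False by (simp add: comp_def cong: holomorphic_cong)
  qed
  have main: "deriv (deriv (S m)) x + (\<Sum>k\<le>m + 1. deriv (S k) x * deriv (S (m + 1 - k)) x) = 0"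
    if m: "m \<ge> 2" and x: "x \<in> N" for m x
  proof -
    define w where "w = zsec x"
    have w: "w \<in> U" "xz w = x" using x loc_section(4) by (auto simp: w_def U_def)
    have "xz ` U \<subseteq> N" using xzN by blast
    note change = wkb_change_of_variable[where S = S and T = "diag_sum F" and Om = Om and \<xi> = xz and M = m,
        OF U w(1) loc_section(1) this xz_hol_U xz_nz[OF w(1)] S_hol]
    show ?thesis
    proof (rule change[unfolded w(2)])
      show "Om w * deriv (diag_sum F (Suc m)) w =
        deriv (deriv (diag_sum F m)) w - deriv Om w / Om w * deriv (diag_sum F m) w +
        (\<Sum>j\<le>Suc m. (if j < 2 then 0 else deriv (diag_sum F j) w) *
          (if Suc m - j < 2 then 0 else deriv (diag_sum F (Suc m - j)) w))"
        by (rule diag_sum_recursion[where F = F and om = "omega e" and sg = sg and Om = Om and U = U])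
          (fact U sg(2) Om_hol Om_nz om F_functions recursion w(1) m)+
    qed (fact S0_nz[OF x] S1[OF x] T Om m)+
  qed
  have "wkb_solution (rees_generator AC q \<alpha>) S N"
  proof (rule wkb_solution_rees_generator)
    show "(deriv (S 0) x)\<^sup>2 - coef AC q \<alpha> x = 0" if "x \<in> N" for x
      using that by (rule S0)
    fix m :: nat and x assume x: "x \<in> N"
    \<comment> \<open>The cases 0 and 1 are the given equations for \<open>S 1\<close> and
      \<open>S 2\<close>.\<close>
    consider "m = 0" | "m = 1" | "m \<ge> 2" by linarith
    then show "deriv (deriv (S m)) x + (\<Sum>k\<le>m + 1. deriv (S k) x * deriv (S (m + 1 - k)) x) = 0"
    proof cases
      case 1
      then show ?thesis using S1[OF x] by (simp add: algebra_simps)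
    next
      case 2
      then show ?thesis
        using S2[OF x] by (simp add: numeral_2_eq_2 power2_eq_square algebra_simps)
    qed (use main x in auto)
  qed
  with S2_eq main show ?thesis by blast
qed

end
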